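(* Let $S\subseteq\mathbb R^d$ ($d\ge1$) be a non-empty set which is a Polish space in the subspace topology, with Borel $\sigma$-algebra $\mathcal S$, let $R$ be a Markov kernel on $(S,\mathcal S)$ and $U_0$ a probability measure on $(S,\mathcal S)$. Consider the urn model with colors indexed by $S$, replacement kernel $R$ and initial configuration $U_0$, with drawn colors $(Z_n)_{n\ge0}$. Suppose there exist a (non-random) probability measure $\Lambda$ on $(\mathbb R^d,\mathcal B_{\mathbb R^d})$, a vector $\mathbf v\in\mathbb R^d$ and functions $a:\mathbb R_+\to\mathbb R$, $b:\mathbb R_+\to\mathbb R_+$ such that, for the Markov chain $(X_n)_{n\ge0}$ with transition kernel $R$ started from any initial distribution on $S$, $$\frac{X_n-a(n)\mathbf v}{b(n)}\Rightarrow\Lambda .$$ Then, as $n\to\infty$: (a) If $a\equiv0$ and $b\equiv1$, then $Z_n\Rightarrow\Lambda$. (b) If $a\equiv0$ and $b$ is regularly varying, then $\frac{Z_n-a(\log n)\mathbf v}{b(\log n)}\Rightarrow\Lambda$. (c) If $a$ is differentiable with $\lim_{x\to\infty}a'(x)=\tilde a<\infty$, and $b$ is regularly varying with $\lim_{x\to\infty}\frac{\sqrt x}{b(x)}=\tilde b<\infty$, then $\frac{Z_n-a(\log n)\mathbf v}{b(\log n)}\Rightarrow\Xi$, where $\Xi=\Lambda$ if $\tilde a=0$ or $\tilde b=0$, and otherwise $\Xi$ is the convolution of $\Lambda$ and $\mathrm{Normal}(0,\tilde a^2\tilde b^2)\,\mathbf v$.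
   Context: A Markov kernel $R$ on $(S,\mathcal S)$ is a map $R:S\times\mathcal S\to[0,1]$ such that $R(s,\cdot)$ is a probability measure for every $s$ and $s\mapsto R(s,A)$ is measurable for every $A\in\mathcal S$. Urn model: given the probability measure $U_0$ (non-random), the random finite measures $U_n$ on $(S,\mathcal S)$ and random colors $Z_n\in S$ are defined recursively for $n\ge0$ by: conditionally on the past (the previous draws $Z_0,\dots,Z_{n-1}$, hence $U_0,\dots,U_n$), $Z_n$ has distribution $U_n/(n+1)$; and $U_{n+1}(A)=U_n(A)+R(Z_n,A)$ for $A\in\mathcal S$. The marginal law of $Z_n$ is $\mathbf E[U_n]/(n+1)$. $\Rightarrow$ is convergence in distribution. Regular variation is at infinity. $\mathrm{Normal}(0,\sigma^2)\mathbf v$ denotes the law of $N\mathbf v$ with $N\sim\mathrm{Normal}(0,\sigma^2)$ a real random variable; $\tilde a,\tilde b$ are finite real numbers. *)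

theory Defs
  imports "HOL-Probability.Probability"
begin

definition Polish_topology :: "'a topology \<Rightarrow> bool" where
  "Polish_topology T \<longleftrightarrow> completely_metrizable_space T \<and> separable_space T"

definition weakly_converges :: "(nat \<Rightarrow> 'b::topological_space measure) \<Rightarrow> 'b measure \<Rightarrow> bool" where
  "weakly_converges \<mu> \<Lambda> \<longleftrightarrow>
     (\<forall>f :: 'b \<Rightarrow> real. continuous_on UNIV f \<and> bounded (range f) \<longrightarrow>
        (\<lambda>n. \<integral>x. f x \<partial>\<mu> n) \<longlonglongrightarrow> (\<integral>x. f x \<partial>\<Lambda>))"

definition converges_in_distribution ::
    "'w measure \<Rightarrow> (nat \<Rightarrow> 'w \<Rightarrow> 'b::topological_space) \<Rightarrow> 'b measure \<Rightarrow> bool" where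
  "converges_in_distribution \<Omega> Y \<Lambda> \<longleftrightarrow> weakly_converges (\<lambda>n. distr \<Omega> borel (Y n)) \<Lambda>"

text \<open>The \<open>\<sigma>\<close>-algebra on \<open>\<Omega>\<close> generated by the tuple \<open>(Y 0, \<dots>, Y (n - 1))\<close>; it is trivial for
  \<open>n = 0\<close>.\<close>

definition past ::
    "'w measure \<Rightarrow> 's measure \<Rightarrow> (nat \<Rightarrow> 'w \<Rightarrow> 's) \<Rightarrow> nat \<Rightarrow> 'w measure" where
  "past \<Omega> M Y n =
     vimage_algebra (space \<Omega>) (\<lambda>\<omega>. \<lambda>i\<in>{..<n}. Y i \<omega>) (Pi\<^sub>M {..<n} (\<lambda>_. M))"

text \<open>A Markov kernel on a measurable space \<open>M\<close> is a measurable map \<open>R \<in> M \<rightarrow>\<^sub>M prob_algebra M\<close>.\<close>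

locale markov_chain = prob_space \<Omega> for \<Omega> :: "'w measure" +
  fixes M :: "'s measure" and R :: "'s \<Rightarrow> 's measure" and \<mu> :: "'s measure"
    and X :: "nat \<Rightarrow> 'w \<Rightarrow> 's"
  assumes kernel: "R \<in> M \<rightarrow>\<^sub>M prob_algebra M"
    and X_measurable: "X n \<in> \<Omega> \<rightarrow>\<^sub>M M"
    and initial_law: "distr \<Omega> M (X 0) = \<mu>"
    and transition: "A \<in> sets M \<Longrightarrow>
      AE \<omega> in \<Omega>. real_cond_exp \<Omega> (past \<Omega> M X (Suc n))
        (indicator (X (Suc n) -` A \<inter> space \<Omega>)) \<omega> = measure (R (X n \<omega>)) A"

locale urn_model = prob_space \<Omega> for \<Omega> :: "'w measure" +
  fixes M :: "'s measure" and R :: "'s \<Rightarrow> 's measure" and U\<^sub>0 :: "'s measure"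
    and U :: "nat \<Rightarrow> 'w \<Rightarrow> 's measure" and Z :: "nat \<Rightarrow> 'w \<Rightarrow> 's"
  assumes kernel: "R \<in> M \<rightarrow>\<^sub>M prob_algebra M"
    and initial_prob: "U\<^sub>0 \<in> space (prob_algebra M)"
    and Z_measurable: "Z n \<in> \<Omega> \<rightarrow>\<^sub>M M"
    and sets_U: "\<omega> \<in> space \<Omega> \<Longrightarrow> sets (U n \<omega>) = sets M"
    and U_0: "\<omega> \<in> space \<Omega> \<Longrightarrow> U 0 \<omega> = U\<^sub>0"
    and U_Suc: "\<omega> \<in> space \<Omega> \<Longrightarrow> A \<in> sets M \<Longrightarrow>
      emeasure (U (Suc n) \<omega>) A = emeasure (U n \<omega>) A + emeasure (R (Z n \<omega>)) A"
    and draw: "A \<in> sets M \<Longrightarrow>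
      AE \<omega> in \<Omega>. real_cond_exp \<Omega> (past \<Omega> M Z n)
        (indicator (Z n -` A \<inter> space \<Omega>)) \<omega> = measure (U n \<omega>) A / real (n + 1)"

text \<open>Regular variation at infinity (with some index \<open>\<rho>\<close>) of a function on \<open>[0, \<infinity>)\<close>. As usual,
  measurability and positivity near infinity are part of the notion.\<close>

definition regularly_varying :: "(real \<Rightarrow> real) \<Rightarrow> bool" where
  "regularly_varying f \<longleftrightarrow>
     f \<in> borel_measurable (restrict_space borel {0..}) \<and>
     eventually (\<lambda>x. f x > 0) at_top \<and>
     (\<exists>\<rho>. \<forall>c>0. ((\<lambda>x. f (c * x) / f x) \<longlongrightarrow> c powr \<rho>) at_top)"

text \<open>The law of \<open>N v\<close> for a centred normal variable \<open>N\<close> with variance \<open>s > 0\<close>; the second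
  argument of \<^const>\<open>normal_density\<close> is the standard deviation.\<close>

definition normal_along :: "real \<Rightarrow> 'b::real_normed_vector \<Rightarrow> 'b measure" where
  "normal_along s v =
     distr (density lborel (\<lambda>x. ennreal (normal_density 0 (sqrt s) x))) borel (\<lambda>x. x *\<^sub>R v)"

end

theory Submission
  imports Defs
begin

text \<open>
  Averaging the urn recursion gives \<open>(n+2) law(Z (n+1)) = (n+1) law(Z n) + law(Z n) R\<close>. Hence \<open>Z n\<close> is
  distributed as \<open>X K\<close>, where \<open>X\<close> is the chain started from \<open>U\<^sub>0\<close> and \<open>K = K(n)\<close> is an independent sum of
  Bernoulli variables with parameters \<open>1/2, \<dots>, 1/(n+1)\<close>. By comparing characteristic functions with
  those of Poisson laws, \<open>(K - ln n) / sqrt (ln n)\<close> is asymptotically standard normal.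
  In \<open>(X K - a(ln n) v) / b(ln n) = (b(K) / b(ln n)) ((X K - a(K) v) / b(K)) + ((a(K) - a(ln n)) / b(ln n)) v\<close>
  the first factor tends to \<open>1\<close> by the uniform convergence theorem for regularly varying functions,
  and the last coefficient is asymptotic to \<open>a' b'\<close> times a standard normal variable (with
  \<open>a'\<close>, \<open>b'\<close> the limits in part (c)) by the mean value theorem. Realising the normal limit
  almost surely by Skorohod's theorem reduces everything to deterministic sequences of step numbers
  and dominated convergence.
\<close>

section \<open>Existence and marginal laws of the Markov chain\<close>

lemma measurable_past:
  "(\<lambda>\<omega>. \<lambda>i\<in>{..<n}. Y i \<omega>) \<in> space \<Omega> \<rightarrow> space (Pi\<^sub>M {..<n} (\<lambda>_. M)) \<Longrightarrow>
   (\<lambda>\<omega>. \<lambda>i\<in>{..<n}. Y i \<omega>) \<in> past \<Omega> M Y n \<rightarrow>\<^sub>M Pi\<^sub>M {..<n} (\<lambda>_. M)"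
  unfolding past_def by (rule measurable_vimage_algebra1)

lemma subalgebra_past:
  assumes "\<And>i. Y i \<in> \<Omega> \<rightarrow>\<^sub>M M"
  shows "subalgebra \<Omega> (past \<Omega> M Y n)"
proof -
  have *: "(\<lambda>\<omega>. \<lambda>i\<in>{..<n}. Y i \<omega>) \<in> \<Omega> \<rightarrow>\<^sub>M Pi\<^sub>M {..<n} (\<lambda>_. M)"
    using assms by (intro measurable_restrict) auto
  show ?thesis
    unfolding subalgebra_def past_def
    using measurable_sets[OF *] measurable_space[OF *]
    by (auto simp: sets_vimage_algebra2 Pi_iff)
qed

text \<open>Integrating a version of a conditional probability over the whole space removes the
  conditioning. The marginal laws of the chain and of the urn are extracted from their conditional
  specifications in this way.\<close>

lemma (in prob_space)
  fixes h :: "'a \<Rightarrow> real"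
  assumes Y: "\<And>i. Y i \<in> M \<rightarrow>\<^sub>M N" and B: "B \<in> sets M" and h: "h \<in> borel_measurable M"
    and ae: "AE \<omega> in M. real_cond_exp M (past M N Y n) (indicator B) \<omega> = h \<omega>"
  shows integrable_conditional_prob: "integrable M h"
    and expectation_conditional_prob: "expectation h = prob B"
proof -
  interpret F: finite_measure_subalgebra M "past M N Y n"
    by unfold_locales (rule subalgebra_past[OF Y])
  have int: "integrable M (indicator B :: 'a \<Rightarrow> real)"
    using B by (auto simp: integrable_indicator_iff less_top[symmetric])
  note I = F.real_cond_exp_int[OF int]
  show "integrable M h"
    using I(1) ae h integrable_cong_AE_imp by blast
  have "expectation h = (\<integral>x. real_cond_exp M (past M N Y n) (indicator B) x \<partial>M)"
    using ae h by (intro integral_cong_AE) auto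
  also have "\<dots> = prob B" using I(2) B by simp
  finally show "expectation h = prob B" .
qed

text \<open>Averaging the transition rule over the past leaves a recursion for the marginals alone:
  they are the iterates of the kernel applied to the initial law.\<close>

lemma (in markov_chain) distr_Suc:
  "distr \<Omega> M (X (Suc n)) = distr \<Omega> M (X n) \<bind> R"
proof (rule measure_eqI)
  note X_measurable[measurable] kernel[measurable]
  have D: "distr \<Omega> M (X n) \<in> space (prob_algebra M)"
    by (simp add: space_prob_algebra prob_space_distr)
  show "sets (distr \<Omega> M (X (Suc n))) = sets (distr \<Omega> M (X n) \<bind> R)"
    using sets_bind'[OF D kernel] by simp
  fix A assume "A \<in> sets (distr \<Omega> M (X (Suc n)))"
  then have A[measurable]: "A \<in> sets M" by simp
  have "emeasure (distr \<Omega> M (X n) \<bind> R) A = (\<integral>\<^sup>+\<omega>. emeasure (R (X n \<omega>)) A \<partial>\<Omega>)"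
    unfolding emeasure_bind_prob_algebra[OF D kernel A]
    using measurable_prob_algebraD[OF kernel] by (subst nn_integral_distr) auto
  also have "\<dots> = (\<integral>\<^sup>+\<omega>. ennreal (measure (R (X n \<omega>)) A) \<partial>\<Omega>)"
  proof (intro nn_integral_cong)
    fix \<omega> assume "\<omega> \<in> space \<Omega>"
    then have "R (X n \<omega>) \<in> space (prob_algebra M)"
      using measurable_space[OF kernel] measurable_space[OF X_measurable] by blast
    then interpret R: prob_space "R (X n \<omega>)" by (simp add: space_prob_algebra)
    show "emeasure (R (X n \<omega>)) A = ennreal (measure (R (X n \<omega>)) A)"
      by (rule R.emeasure_eq_measure)
  qed
  also have "\<dots> = ennreal (\<integral>\<omega>. measure (R (X n \<omega>)) A \<partial>\<Omega>)"
    by (intro nn_integral_eq_integral integrable_conditional_prob[OF X_measurable _ _ transition[OF A, of n]]) auto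
  also have "\<dots> = ennreal (prob (X (Suc n) -` A \<inter> space \<Omega>))"
    by (subst expectation_conditional_prob[OF X_measurable _ _ transition[OF A, of n]]) auto
  also have "\<dots> = emeasure (distr \<Omega> M (X (Suc n))) A"
    by (simp add: emeasure_distr emeasure_eq_measure)
  finally show "emeasure (distr \<Omega> M (X (Suc n))) A = emeasure (distr \<Omega> M (X n) \<bind> R) A" ..
qed

text \<open>A limit hypothesis about all chains on the space of sequences yields information only
  once such a chain is at hand. The Ionescu-Tulcea theorem supplies a measure on sequences under
  which the coordinate process is one.\<close>

lemma markov_chain_exists:
  fixes M :: "'s measure"
  assumes R[measurable]: "R \<in> M \<rightarrow>\<^sub>M prob_algebra M" and \<mu>: "prob_space \<mu>" "sets \<mu> = sets M"
  shows "\<exists>(\<Omega> :: (nat \<Rightarrow> 's) measure) X. markov_chain \<Omega> M R \<mu> X"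
proof -
  \<comment> \<open>\<open>P i\<close> is the law of coordinate \<open>i\<close> given the
    coordinates before it: the initial law for \<open>i = 0\<close>, otherwise the kernel at the
    preceding coordinate.\<close>
  define P where "P i \<omega> = (case i of 0 \<Rightarrow> \<mu> | Suc j \<Rightarrow> R (\<omega> j))" for i and \<omega> :: "nat \<Rightarrow> 's"
  have \<mu>': "\<mu> \<in> space (prob_algebra M)" using \<mu> by (simp add: space_prob_algebra)
  have P: "P i \<in> Pi\<^sub>M {0..<i} (\<lambda>_. M) \<rightarrow>\<^sub>M prob_algebra M" for i
  proof (cases i)
    case 0
    have "P 0 = (\<lambda>_. \<mu>)" by (simp add: P_def fun_eq_iff)
    then show ?thesis using \<mu>' 0 by simp
  next
    case (Suc j)
    then have "(\<lambda>\<omega>. \<omega> j) \<in> Pi\<^sub>M {0..<i} (\<lambda>_. M) \<rightarrow>\<^sub>M M"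
      by (intro measurable_component_singleton) auto
    moreover have "P i = (\<lambda>\<omega>. R (\<omega> j))" by (simp add: P_def Suc fun_eq_iff)
    ultimately show ?thesis using measurable_compose[OF _ R] by simp
  qed
  interpret IT: Ionescu_Tulcea P "\<lambda>_. M"
  proof (rule Ionescu_Tulcea.intro)
    fix i
    show "P i \<in> Pi\<^sub>M {0..<i} (\<lambda>_. M) \<rightarrow>\<^sub>M subprob_algebra M"
      by (rule measurable_prob_algebraD[OF P])
    fix x assume "x \<in> space (Pi\<^sub>M {0..<i} (\<lambda>_. M))"
    from measurable_space[OF P this] show "prob_space (P i x)"
      by (simp add: space_prob_algebra)
  qed
  define L where "L = IT.PF.lim"
  \<comment> \<open>The joint law of the first \<open>n\<close> coordinates. The undefined function
    is the only point of the empty product, where the construction starts.\<close>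
  define C where "C n = IT.C 0 n (\<lambda>_. undefined)" for n
  have sets_L[measurable_cong]: "sets L = sets (Pi\<^sub>M UNIV (\<lambda>_. M))"
    unfolding L_def by (rule IT.PF.sets_lim)
  have und: "(\<lambda>_. undefined) \<in> space (Pi\<^sub>M {0..<0::nat} (\<lambda>_. M))" by (simp add: space_PiM)
  have setsC: "sets (C n) = sets (Pi\<^sub>M {0..<n} (\<lambda>_. M))" for n
    using IT.sets_C[OF und, of n] by (simp add: C_def)
  have spaceC: "space (C n) = space (Pi\<^sub>M {0..<n} (\<lambda>_. M))" for n
    by (rule sets_eq_imp_space_eq[OF setsC])
  \<comment> \<open>\<open>IT.CI J\<close> projects the joint law of the first
    \<open>IT.up_to J\<close> coordinates onto \<open>J\<close>; for an initial segment this
    projection is the identity.\<close>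
  have up_to: "IT.up_to {0..<n} = n" for n
  proof (rule antisym)
    show "IT.up_to {0..<n} \<le> n" by (simp add: IT.up_to_iff)
    show "n \<le> IT.up_to {0..<n}"
      using IT.up_to[of "{0..<n}"] by (cases n) auto
  qed
  have fdd: "distr L (Pi\<^sub>M {0..<n} (\<lambda>_. M)) (\<lambda>\<omega>. restrict \<omega> {0..<n}) = C n" for n
  proof -
    have "distr L (Pi\<^sub>M {0..<n} (\<lambda>_. M)) (\<lambda>\<omega>. restrict \<omega> {0..<n}) = IT.CI {0..<n}"
      unfolding L_def by (rule IT.distr_lim) simp
    also have "\<dots> = distr (C n) (C n) (\<lambda>x. x)"
      unfolding IT.CI_def up_to C_def[symmetric]
      by (intro distr_cong) (auto simp: setsC spaceC space_PiM PiE_restrict)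
    also have "\<dots> = C n" by (rule distr_id)
    finally show ?thesis .
  qed
  have restr[measurable]: "(\<lambda>\<omega>. restrict \<omega> {0..<n}) \<in> L \<rightarrow>\<^sub>M Pi\<^sub>M {0..<n} (\<lambda>_. M)" for n
    by (auto intro!: measurable_restrict measurable_component_singleton simp: measurable_cong_sets[OF sets_L refl])
  have prL: "prob_space L"
  proof -
    have "prob_space (C 0)" using IT.prob_space_C[OF und, of 0] by (simp add: C_def)
    then show ?thesis using prob_space_distrD[OF restr[of 0]] by (simp only: fdd)
  qed
  then interpret L: prob_space L .
  have coord: "(\<lambda>\<omega>. \<omega> n) \<in> L \<rightarrow>\<^sub>M M" for n
    by (auto intro!: measurable_component_singleton simp: measurable_cong_sets[OF sets_L refl])
  \<comment> \<open>The Markov property in integrated form, tested against any nonnegative function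
    of the first \<open>n\<close> coordinates. The weight \<open>1\<close> at \<open>n = 0\<close>
    gives the initial law, indicators of past events give the conditional probabilities.\<close>
  have step: "(\<integral>\<^sup>+\<omega>. g (restrict \<omega> {0..<n}) * indicator A (\<omega> n) \<partial>L) =
     (\<integral>\<^sup>+\<omega>. g (restrict \<omega> {0..<n}) * emeasure (P n \<omega>) A \<partial>L)"
    if g[measurable]: "g \<in> borel_measurable (Pi\<^sub>M {0..<n} (\<lambda>_. M))" and A[measurable]: "A \<in> sets M" for g n A
  proof -
    have co[measurable]: "(\<lambda>\<omega>. \<omega> n) \<in> Pi\<^sub>M {0..<Suc n} (\<lambda>_. M) \<rightarrow>\<^sub>M M"
      by (intro measurable_component_singleton) auto
    have re[measurable]: "(\<lambda>\<omega>. restrict \<omega> {0..<n}) \<in> Pi\<^sub>M {0..<Suc n} (\<lambda>_. M) \<rightarrow>\<^sub>M Pi\<^sub>M {0..<n} (\<lambda>_. M)"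
      by (intro measurable_restrict measurable_component_singleton) auto
    have PA[measurable]: "(\<lambda>\<omega>. emeasure (P n \<omega>) A) \<in> borel_measurable (Pi\<^sub>M {0..<n} (\<lambda>_. M))"
      using measurable_emeasure_subprob_algebra[OF A] IT.P[of n] by (rule measurable_compose[rotated])
    have "(\<integral>\<^sup>+\<omega>. g (restrict \<omega> {0..<n}) * indicator A (\<omega> n) \<partial>L) =
       (\<integral>\<^sup>+\<omega>. g (restrict (restrict \<omega> {0..<Suc n}) {0..<n}) * indicator A ((restrict \<omega> {0..<Suc n}) n) \<partial>L)"
      by (simp add: Int_absorb1 atLeastLessThanSuc subset_insertI)
    also have "\<dots> = (\<integral>\<^sup>+\<omega>. g (restrict \<omega> {0..<n}) * indicator A (\<omega> n) \<partial>C (Suc n))"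
      unfolding fdd[symmetric] by (subst nn_integral_distr[OF restr]) (auto)
    also have "\<dots> = (\<integral>\<^sup>+\<omega>. \<integral>\<^sup>+\<omega>'. g (restrict \<omega>' {0..<n}) * indicator A (\<omega>' n) \<partial>IT.eP n \<omega> \<partial>C n)"
      unfolding C_def IT.C.simps
      using IT.measurable_eP[of n]
      by (subst nn_integral_bind[where B="Pi\<^sub>M {0..<Suc n} (\<lambda>_. M)"])
         (auto simp: measurable_cong_sets[OF IT.sets_C[OF und] refl])
    also have "\<dots> = (\<integral>\<^sup>+\<omega>. g \<omega> * emeasure (P n \<omega>) A \<partial>C n)"
    proof (intro nn_integral_cong)
      fix \<omega> assume "\<omega> \<in> space (C n)"
      then have \<omega>: "\<omega> \<in> space (Pi\<^sub>M {0..<n} (\<lambda>_. M))" by (simp add: spaceC)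
      have "(\<integral>\<^sup>+\<omega>'. g (restrict \<omega>' {0..<n}) * indicator A (\<omega>' n) \<partial>IT.eP n \<omega>) =
        (\<integral>\<^sup>+x. g (restrict (fun_upd \<omega> n x) {0..<n}) * indicator A ((fun_upd \<omega> n x) n) \<partial>P n \<omega>)"
        by (rule IT.nn_integral_eP[OF \<omega>]) measurable
      also have "\<dots> = (\<integral>\<^sup>+x. g \<omega> * indicator A x \<partial>P n \<omega>)"
      proof -
        have "restrict (fun_upd \<omega> n x) {0..<n} = \<omega>" for x
          using \<omega> by (auto simp: space_PiM fun_eq_iff restrict_def PiE_def extensional_def)
        then show ?thesis by simp
      qed
      also have "\<dots> = g \<omega> * emeasure (P n \<omega>) A"
        using A IT.sets_P[OF \<omega>] by (subst nn_integral_cmult_indicator) auto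
      finally show "(\<integral>\<^sup>+\<omega>'. g (restrict \<omega>' {0..<n}) * indicator A (\<omega>' n) \<partial>IT.eP n \<omega>) = g \<omega> * emeasure (P n \<omega>) A" .
    qed
    also have "\<dots> = (\<integral>\<^sup>+\<omega>. g (restrict \<omega> {0..<n}) * emeasure (P n (restrict \<omega> {0..<n})) A \<partial>L)"
      unfolding fdd[symmetric] by (subst nn_integral_distr[OF restr]) auto
    also have "\<dots> = (\<integral>\<^sup>+\<omega>. g (restrict \<omega> {0..<n}) * emeasure (P n \<omega>) A \<partial>L)"
    proof -
      have "P n (restrict \<omega> {0..<n}) = P n \<omega>" for \<omega> by (cases n) (simp_all add: P_def)
      then show ?thesis by simp
    qed
    finally show ?thesis .
  qed
  define X where "X n \<omega> = \<omega> n" for n and \<omega> :: "nat \<Rightarrow> 's"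
  have X_meas[measurable]: "X n \<in> L \<rightarrow>\<^sub>M M" for n unfolding X_def by (rule coord)
  have "markov_chain L M R \<mu> X"
  proof
    show "R \<in> M \<rightarrow>\<^sub>M prob_algebra M" by fact
    show "X n \<in> L \<rightarrow>\<^sub>M M" for n by fact
    show "distr L M (X 0) = \<mu>"
    proof (rule measure_eqI)
      fix A assume "A \<in> sets (distr L M (X 0))"
      then have A: "A \<in> sets M" by simp
      have "emeasure (distr L M (X 0)) A = (\<integral>\<^sup>+\<omega>. 1 * indicator A (\<omega> 0) \<partial>L)"
        using A by (simp add: nn_integral_indicator[symmetric] nn_integral_distr X_def[symmetric] del: nn_integral_indicator)
      also have "\<dots> = emeasure \<mu> A"
        by (subst step[OF _ A, of "\<lambda>_. 1"]) (auto simp: P_def L.emeasure_space_1)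
      finally show "emeasure (distr L M (X 0)) A = emeasure \<mu> A" .
    qed (simp add: \<mu>)
    fix A n assume A[measurable]: "A \<in> sets M"
    let ?F = "past L M X (Suc n)"
    interpret F: finite_measure_subalgebra L ?F
      by unfold_locales (rule subalgebra_past[OF X_meas])
    have R_eq: "emeasure (R (X n \<omega>)) A = ennreal (measure (R (X n \<omega>)) A)"
       and R_le: "measure (R (X n \<omega>)) A \<le> 1" if "\<omega> \<in> space L" for \<omega>
    proof -
      have "R (X n \<omega>) \<in> space (prob_algebra M)"
        using that measurable_space[OF R] measurable_space[OF X_meas] by blast
      then interpret R: prob_space "R (X n \<omega>)" by (simp add: space_prob_algebra)
      show "emeasure (R (X n \<omega>)) A = ennreal (measure (R (X n \<omega>)) A)"
        by (rule R.emeasure_eq_measure)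
      show "measure (R (X n \<omega>)) A \<le> 1" by (rule R.prob_le_1)
    qed
    have int1: "integrable L (indicator (X (Suc n) -` A \<inter> space L) :: _ \<Rightarrow> real)"
      by (auto simp: integrable_indicator_iff less_top[symmetric])
    have int2: "integrable L (\<lambda>\<omega>. measure (R (X n \<omega>)) A)"
      by (rule L.integrable_const_bound[where B=1]) (auto simp: R_le)
    have tup: "(\<lambda>\<omega>. \<lambda>i\<in>{..<Suc n}. X i \<omega>) \<in> space L \<rightarrow> space (Pi\<^sub>M {..<Suc n} (\<lambda>_. M))"
      using measurable_space[OF X_meas] by (auto simp: space_PiM)
    show "AE \<omega> in L. real_cond_exp L ?F (indicator (X (Suc n) -` A \<inter> space L)) \<omega> = measure (R (X n \<omega>)) A"
    proof (rule F.real_cond_exp_charact[OF _ int1 int2])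
      have "(\<lambda>\<omega>. (\<lambda>i\<in>{..<Suc n}. X i \<omega>) n) \<in> ?F \<rightarrow>\<^sub>M M"
        by (rule measurable_compose[OF measurable_past[OF tup] measurable_component_singleton]) simp
      then show "(\<lambda>\<omega>. measure (R (X n \<omega>)) A) \<in> borel_measurable ?F"
        by simp
      fix D assume D: "D \<in> sets ?F"
      \<comment> \<open>Past events are the preimages of product-measurable sets under the tuple of
        the first \<open>n + 1\<close> coordinates, so \<open>step\<close> with the indicator of
        \<open>B\<close> compares the two integrals over \<open>D\<close>.\<close>
      then obtain B where B[measurable]: "B \<in> sets (Pi\<^sub>M {..<Suc n} (\<lambda>_. M))"
        and DB: "D = (\<lambda>\<omega>. \<lambda>i\<in>{..<Suc n}. X i \<omega>) -` B \<inter> space L"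
        unfolding past_def sets_vimage_algebra2[OF tup] by auto
      have B'[measurable]: "B \<in> sets (Pi\<^sub>M {0..<Suc n} (\<lambda>_. M))" using B by (simp add: lessThan_atLeast0)
      have ind: "indicator D \<omega> = indicator B (restrict \<omega> {0..<Suc n})" if "\<omega> \<in> space L" for \<omega>
        using that unfolding DB X_def by (auto simp: indicator_def lessThan_atLeast0 restrict_def)
      have [measurable]: "D \<in> sets L" using D F.subalg unfolding subalgebra_def by auto
      have "ennreal (\<integral>x\<in>D. indicator (X (Suc n) -` A \<inter> space L) x \<partial>L) =
         (\<integral>\<^sup>+x. indicator D x * indicator A (x (Suc n)) \<partial>L)"
        unfolding set_lebesgue_integral_def
        by (subst nn_integral_eq_integral[symmetric])
           (auto intro!: nn_integral_cong L.integrable_const_bound[where B=1] simp: X_def split: split_indicator)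
      also have "\<dots> = (\<integral>\<^sup>+\<omega>. indicator B (restrict \<omega> {0..<Suc n}) * indicator A (\<omega> (Suc n)) \<partial>L)"
        by (intro nn_integral_cong) (simp add: ind)
      also have "\<dots> = (\<integral>\<^sup>+\<omega>. indicator B (restrict \<omega> {0..<Suc n}) * emeasure (P (Suc n) \<omega>) A \<partial>L)"
        by (rule step) measurable
      also have "\<dots> = (\<integral>\<^sup>+\<omega>. ennreal (indicator D \<omega> * measure (R (X n \<omega>)) A) \<partial>L)"
        by (intro nn_integral_cong) (auto simp: ind[symmetric] P_def R_eq[unfolded X_def] X_def split: split_indicator)
      also have "\<dots> = ennreal (\<integral>x\<in>D. measure (R (X n x)) A \<partial>L)"
        unfolding set_lebesgue_integral_def
        by (subst nn_integral_eq_integral)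
           (auto intro!: L.integrable_const_bound[where B=1] simp: R_le split: split_indicator)
      finally show "(\<integral>x\<in>D. indicator (X (Suc n) -` A \<inter> space L) x \<partial>L) = (\<integral>x\<in>D. measure (R (X n x)) A \<partial>L)"
        by (subst (asm) ennreal_inj) (auto simp: set_lebesgue_integral_def)
    qed
  qed
  then show ?thesis by blast
qed

section \<open>The random number of steps\<close>

text \<open>Law of a sum of independent Bernoulli variables with parameters \<open>1/2, \<dots>, 1/(n+1)\<close>: averaging
  the urn recursion shows that \<open>Z n\<close> has the law of the Markov chain after that many steps.\<close>

primrec draw_count :: "nat \<Rightarrow> nat pmf" where
  "draw_count 0 = return_pmf 0"
| "draw_count (Suc n) =
     bind_pmf (bernoulli_pmf (1 / real (n + 2))) (\<lambda>c. map_pmf (\<lambda>k. k + of_bool c) (draw_count n))"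

lemma finite_set_draw_count: "finite (set_pmf (draw_count n))"
  by (induction n) auto

text \<open>The generating function of a sum of independent Bernoulli variables factorises, and a
  coin with parameter \<open>p = 1 / (j + 2)\<close> contributes
  \<open>1 - p + p * z\<close>.\<close>

lemma expectation_draw_count_power:
  fixes z :: complex
  shows "measure_pmf.expectation (draw_count n) (\<lambda>k. z ^ k) = (\<Prod>j<n. 1 + (z - 1) / of_nat (j + 2))"
proof (induction n)
  case (Suc n)
  let ?E = "measure_pmf.expectation (draw_count n) (\<lambda>k. z ^ k)"
  have int: "integrable (draw_count n) (\<lambda>k. z ^ k)"
    by (rule integrable_measure_pmf_finite[OF finite_set_draw_count])
  have "measure_pmf.expectation (draw_count (Suc n)) (\<lambda>k. z ^ k) =
    (1 / real (n + 2)) *\<^sub>R (z * ?E) + (1 - 1 / real (n + 2)) *\<^sub>R ?E"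
    using int by (simp add: pmf_expectation_bind[of UNIV] finite_set_draw_count UNIV_bool)
  also have "\<dots> = ?E * (1 + (z - 1) / of_nat (n + 2))"
  proof -
    define p where "p = complex_of_nat (n + 2)"
    have "p \<noteq> 0" unfolding p_def of_nat_eq_0_iff by simp
    moreover have "of_real (1 / real (n + 2)) = 1 / p"
      by (simp only: p_def of_real_divide of_real_of_nat_eq of_real_1)
    ultimately show ?thesis
      unfolding p_def[symmetric] scaleR_conv_of_real of_real_diff by (simp add: field_simps)
  qed
  finally show ?case by (simp add: Suc)
qed simp

text \<open>Telescoping: each term is at most \<open>1 / (j + 1) - 1 / (j + 2)\<close>.\<close>

lemma sum_inverse_squares_le_1: "(\<Sum>j<n. 1 / (real (j + 2))\<^sup>2) \<le> 1"
proof -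
  have "(\<Sum>j<n. 1 / (real (j + 2))\<^sup>2) \<le> 1 - 1 / real (n + 1)"
  proof (induction n)
    case (Suc n)
    have "1 / (real (n + 2))\<^sup>2 \<le> 1 / (real (n + 1) * real (n + 2))"
      by (intro divide_left_mono) (auto simp: power2_eq_square intro!: mult_right_mono)
    also have "\<dots> = 1 / real (n + 1) - 1 / real (Suc n + 1)"
      by (simp add: field_simps)
    finally show ?case using Suc by simp
  qed simp
  then show ?thesis by (rule order_trans) simp
qed

text \<open>Poisson approximation: the exponential is the generating function of the Poisson law
  with the same mean \<open>1/2 + ... + 1/(n+1)\<close>. All factors \<open>1 + x j\<close> and
  \<open>exp (x j)\<close> lie in the closed unit disc, so the difference of the products is at most
  the sum of the differences of the factors, each of order \<open>(norm (x j))\<^sup>2\<close>. The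
  bound is uniform in \<open>n\<close> and vanishes as \<open>z\<close> tends to
  \<open>1\<close>.\<close>

lemma expectation_draw_count_power_approx:
  fixes z :: complex
  assumes z: "norm z = 1"
  shows "norm (measure_pmf.expectation (draw_count n) (\<lambda>k. z ^ k) - exp ((z - 1) * of_real (harm (Suc n) - 1)))
    \<le> exp 1 * (norm (z - 1))\<^sup>2"
proof -
  define x where "x j = (z - 1) / of_nat (j + 2)" for j :: nat
  have nz: "norm (z - 1) \<le> 2" using norm_triangle_ineq4[of z 1] z by simp
  have norm_x: "norm (x j) = norm (z - 1) / real (j + 2)" for j
    by (simp only: x_def norm_divide norm_of_nat)
  have x1: "norm (x j) \<le> 1" for j
    unfolding norm_x using nz by (simp add: field_simps)
  have Rez: "Re z \<le> 1" using complex_Re_le_cmod[of z] z by simp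
  have harm: "(\<Sum>j<n. x j) = (z - 1) * of_real (harm (Suc n) - 1)"
    unfolding x_def
    by (induction n) (simp_all add: harm_Suc harm_expand algebra_simps divide_inverse)
  have "norm ((\<Prod>j<n. 1 + x j) - (\<Prod>j<n. exp (x j))) \<le> (\<Sum>j<n. norm ((1 + x j) - exp (x j)))"
  proof (rule norm_prod_diff)
    fix j
    \<comment> \<open>This factor is a convex combination of \<open>1\<close> and \<open>z\<close>,
      hence lies in the unit disc.\<close>
    have "1 + x j = (of_nat (j + 1) + z) / of_nat (j + 2)"
    proof -
      define p where "p = complex_of_nat (j + 2)"
      have "p \<noteq> 0" unfolding p_def of_nat_eq_0_iff by simp
      moreover have "of_nat (j + 1) = p - 1" by (simp add: p_def)
      ultimately show ?thesis unfolding x_def p_def[symmetric] by (simp add: field_simps)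
    qed
    also have "norm \<dots> \<le> (real (j + 1) + 1) / real (j + 2)"
      unfolding norm_divide norm_of_nat
      using norm_triangle_ineq[of "of_nat (j + 1)" z, unfolded norm_of_nat z] by (rule divide_right_mono) simp
    finally show "norm (1 + x j) \<le> 1" by simp
    have "Re (x j) = (Re z - 1) / real (j + 2)"
      unfolding x_def by (simp only: Re_divide_of_nat) simp
    also have "\<dots> \<le> 0" using Rez by (intro divide_nonpos_nonneg) auto
    finally show "norm (exp (x j)) \<le> 1" by simp
  qed
  also have "\<dots> \<le> (\<Sum>j<n. exp 1 * (norm (z - 1))\<^sup>2 * (1 / (real (j + 2))\<^sup>2))"
  proof (rule sum_mono)
    fix j
    have "norm ((1 + x j) - exp (x j)) = norm (exp (x j) - (\<Sum>i\<le>1. x j ^ i / fact i))"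
      by (simp add: norm_minus_commute)
    also have "\<dots> \<le> exp (norm (x j)) * norm (x j) ^ Suc 1 / fact 1"
      by (rule Taylor_exp_field)
    also have "\<dots> \<le> exp 1 * (norm (x j))\<^sup>2"
      using x1 by (simp add: power2_eq_square mult_right_mono)
    finally show "norm ((1 + x j) - exp (x j)) \<le> exp 1 * (norm (z - 1))\<^sup>2 * (1 / (real (j + 2))\<^sup>2)"
      by (simp only: norm_x power_divide) simp
  qed
  also have "\<dots> \<le> exp 1 * (norm (z - 1))\<^sup>2"
    unfolding sum_distrib_left[symmetric]
    using sum_inverse_squares_le_1[of n] by (intro mult_left_le) auto
  finally show ?thesis
    unfolding expectation_draw_count_power x_def[symmetric] harm[symmetric] exp_sum[OF finite_lessThan] .
qed

text \<open>By Levy continuity it suffices to treat characteristic functions, which are generating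
  functions at \<open>z = exp (\<i> * s)\<close> with \<open>s = t / sqrt (ln n)\<close>. After the
  Poisson approximation the exponent is \<open>(z - 1) * h - \<i> * s * l\<close>, where
  \<open>h\<close> is the mean and \<open>l = ln n\<close>. Since
  \<open>z - 1 = \<i> * s - s\<^sup>2 / 2 + O(s\<^sup>3)\<close>, \<open>h - l\<close> is bounded
  and \<open>s\<^sup>2 * l = t\<^sup>2\<close>, it tends to \<open>- t\<^sup>2 / 2\<close>.\<close>

lemma draw_count_central_limit:
  "weak_conv_m (\<lambda>n. distr (draw_count n) borel (\<lambda>k. (real k - ln (real n)) / sqrt (ln (real n))))
     std_normal_distribution"
proof (rule levy_continuity)
  let ?\<mu> = "\<lambda>n. distr (draw_count n) borel (\<lambda>k. (real k - ln (real n)) / sqrt (ln (real n)))"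
  show "real_distribution (?\<mu> n)" for n
    by (rule prob_space.real_distribution_distr) (auto simp: measure_pmf.prob_space_axioms)
  show "real_distribution std_normal_distribution" by (rule real_dist_normal_dist)
  fix t :: real
  define l where "l n = ln (real n)" for n
  define s where "s n = t / sqrt (l n)" for n
  define z where "z n = iexp (s n)" for n
  define h where "h n = harm (Suc n) - (1 :: real)" for n
  have l: "filterlim l at_top sequentially"
    unfolding l_def by (rule filterlim_compose[OF ln_at_top filterlim_real_sequentially])
  have l_pos: "eventually (\<lambda>n. l n > 0) sequentially"
    using l by (simp add: filterlim_at_top_dense)
  have s0: "s \<longlonglongrightarrow> 0"
    unfolding s_def by (intro real_tendsto_divide_at_top[OF tendsto_const] filterlim_compose[OF sqrt_at_top l])
  have "z \<longlonglongrightarrow> exp (\<i> * of_real 0)"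
    unfolding z_def by (intro tendsto_intros s0)
  then have z1: "z \<longlonglongrightarrow> 1" by simp
  have z1': "(\<lambda>n. z n - 1) \<longlonglongrightarrow> 0" using tendsto_diff[OF z1 tendsto_const[of 1]] by simp
  have norm_z: "norm (z n) = 1" for n by (simp add: z_def)
  have sl: "eventually (\<lambda>n. (s n)\<^sup>2 * l n = t\<^sup>2) sequentially"
    using l_pos by eventually_elim (simp add: s_def power_divide)
  have char_eq: "char (?\<mu> n) t = exp (- \<i> * of_real (s n * l n)) * measure_pmf.expectation (draw_count n) (\<lambda>k. z n ^ k)" for n
  proof -
    have "char (?\<mu> n) t = measure_pmf.expectation (draw_count n) (\<lambda>k. iexp (t * ((real k - ln (real n)) / sqrt (ln (real n)))))"
      unfolding char_def by (subst integral_distr) auto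
    also have "\<dots> = measure_pmf.expectation (draw_count n) (\<lambda>k. exp (- \<i> * of_real (s n * l n)) * z n ^ k)"
      unfolding z_def s_def l_def exp_of_nat_mult[symmetric] exp_add[symmetric]
      by (simp add: diff_divide_distrib algebra_simps)
    finally show ?thesis by simp
  qed
  \<comment> \<open>The mean \<open>h\<close> differs from \<open>ln n\<close> by a convergent
    sequence, so exchanging them in the exponent costs \<open>z - 1\<close> times a bounded
    factor.\<close>
  have "(\<lambda>n. harm n - ln (real n) + inverse (real (Suc n)) - 1) \<longlonglongrightarrow> euler_mascheroni + 0 - 1"
    by (intro tendsto_intros euler_mascheroni_LIMSEQ LIMSEQ_inverse_real_of_nat)
  then have hl: "(\<lambda>n. h n - l n) \<longlonglongrightarrow> euler_mascheroni - 1"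
    by (simp add: h_def l_def harm_Suc algebra_simps)
  have E1: "(\<lambda>n. (z n - 1) * of_real (h n - l n)) \<longlonglongrightarrow> 0 * of_real (euler_mascheroni - 1)"
    by (intro tendsto_mult z1' tendsto_of_real hl)
  \<comment> \<open>The second-order Taylor remainder is at most \<open>\<bar>s\<bar>^3\<close>;
    multiplied by \<open>l = t\<^sup>2 / s\<^sup>2\<close> (for \<open>s \<noteq> 0\<close>) it
    still vanishes.\<close>
  have E2: "(\<lambda>n. (z n - 1 - \<i> * of_real (s n) + of_real ((s n)\<^sup>2 / 2)) * of_real (l n)) \<longlonglongrightarrow> 0"
  proof (rule Lim_null_comparison)
    have "(\<lambda>n. \<bar>s n\<bar> * t\<^sup>2) \<longlonglongrightarrow> \<bar>0\<bar> * t\<^sup>2" by (intro tendsto_intros s0)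
    then show "(\<lambda>n. \<bar>s n\<bar> * t\<^sup>2) \<longlonglongrightarrow> 0" by simp
    show "eventually (\<lambda>n. norm ((z n - 1 - \<i> * of_real (s n) + of_real ((s n)\<^sup>2 / 2)) * of_real (l n)) \<le> \<bar>s n\<bar> * t\<^sup>2) sequentially"
      using l_pos sl
    proof eventually_elim
      case (elim n)
      have "norm (z n - 1 - \<i> * of_real (s n) + of_real ((s n)\<^sup>2 / 2)) = norm (iexp (s n) - (\<Sum>k\<le>2. (\<i> * s n) ^ k / fact k))"
        by (simp add: z_def numeral_2_eq_2 power2_eq_square algebra_simps)
      also have "\<dots> \<le> \<bar>s n\<bar> ^ Suc 2 / fact (Suc 2)" by (rule iexp_approx1)
      also have "\<dots> \<le> \<bar>s n\<bar> ^ 3"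
        by (simp add: divide_le_eq fact_numeral del: power_abs)
      finally have "norm ((z n - 1 - \<i> * of_real (s n) + of_real ((s n)\<^sup>2 / 2)) * of_real (l n)) \<le> \<bar>s n\<bar> ^ 3 * l n"
        using elim(1) by (simp add: norm_mult mult_right_mono)
      also have "\<dots> = \<bar>s n\<bar> * ((s n)\<^sup>2 * l n)" by (simp add: power3_eq_cube power2_eq_square)
      finally show ?case using elim(2) by simp
    qed
  qed
  have "(\<lambda>n. (z n - 1) * of_real (h n - l n) + ((z n - 1 - \<i> * of_real (s n) + of_real ((s n)\<^sup>2 / 2)) * of_real (l n)) - of_real (t\<^sup>2 / 2))
     \<longlonglongrightarrow> 0 * of_real (euler_mascheroni - 1) + 0 - complex_of_real (t\<^sup>2 / 2)"
    by (intro tendsto_add tendsto_diff E1 E2 tendsto_const)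
  then have "(\<lambda>n. (z n - 1) * of_real (h n) - \<i> * of_real (s n * l n)) \<longlonglongrightarrow> 0 * of_real (euler_mascheroni - 1) + 0 - complex_of_real (t\<^sup>2 / 2)"
  proof (rule Lim_transform_eventually)
    show "eventually (\<lambda>n. (z n - 1) * of_real (h n - l n) + ((z n - 1 - \<i> * of_real (s n) + of_real ((s n)\<^sup>2 / 2)) * of_real (l n)) - of_real (t\<^sup>2 / 2)
      = (z n - 1) * of_real (h n) - \<i> * of_real (s n * l n)) sequentially"
      using sl
    proof eventually_elim
      case (elim n)
      have "complex_of_real ((s n)\<^sup>2 / 2) * of_real (l n) = of_real (t\<^sup>2 / 2)"
        unfolding of_real_mult[symmetric] elim[symmetric] by simp
      then show ?case by (simp add: algebra_simps)
    qed
  qed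
  then have E: "(\<lambda>n. (z n - 1) * of_real (h n) - \<i> * of_real (s n * l n)) \<longlonglongrightarrow> of_real (- t\<^sup>2 / 2)"
    by simp
  have main: "(\<lambda>n. exp ((z n - 1) * of_real (h n) - \<i> * of_real (s n * l n))) \<longlonglongrightarrow> exp (of_real (- t\<^sup>2 / 2))"
    by (intro tendsto_exp E)
  \<comment> \<open>The centering contributes a factor of modulus one, so the Poisson approximation
    error carries over unchanged.\<close>
  have "(\<lambda>n. char (?\<mu> n) t - exp ((z n - 1) * of_real (h n) - \<i> * of_real (s n * l n))) \<longlonglongrightarrow> 0"
  proof (rule Lim_null_comparison)
    have "(\<lambda>n. exp 1 * (norm (z n - 1))\<^sup>2) \<longlonglongrightarrow> exp 1 * (norm (0::complex))\<^sup>2" by (intro tendsto_intros z1')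
    then show "(\<lambda>n. exp 1 * (norm (z n - 1))\<^sup>2) \<longlonglongrightarrow> 0" by simp
    show "eventually (\<lambda>n. norm (char (?\<mu> n) t - exp ((z n - 1) * of_real (h n) - \<i> * of_real (s n * l n))) \<le> exp 1 * (norm (z n - 1))\<^sup>2) sequentially"
    proof (rule always_eventually, rule allI)
      fix n
      have "char (?\<mu> n) t - exp ((z n - 1) * of_real (h n) - \<i> * of_real (s n * l n)) =
        exp (- \<i> * of_real (s n * l n)) * (measure_pmf.expectation (draw_count n) (\<lambda>k. z n ^ k) - exp ((z n - 1) * of_real (h n)))"
        unfolding char_eq right_diff_distrib exp_add[symmetric] by (simp add: algebra_simps)
      also have "norm \<dots> = norm (measure_pmf.expectation (draw_count n) (\<lambda>k. z n ^ k) - exp ((z n - 1) * of_real (h n)))"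
        by (simp add: norm_mult)
      also have "\<dots> \<le> exp 1 * (norm (z n - 1))\<^sup>2"
        unfolding h_def by (rule expectation_draw_count_power_approx[OF norm_z])
      finally show "norm (char (?\<mu> n) t - exp ((z n - 1) * of_real (h n) - \<i> * of_real (s n * l n))) \<le> exp 1 * (norm (z n - 1))\<^sup>2" .
    qed
  qed
  from tendsto_add[OF this main]
  show "(\<lambda>n. char (?\<mu> n) t) \<longlonglongrightarrow> char std_normal_distribution t"
    by (simp add: char_std_normal_distribution flip: exp_of_real)
qed

section \<open>The law of a draw as a mixture\<close>

lemma (in urn_model) prob_space_R: "x \<in> space M \<Longrightarrow> prob_space (R x)" "x \<in> space M \<Longrightarrow> sets (R x) = sets M"
  using measurable_space[OF kernel] by (auto simp: space_prob_algebra)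

lemma (in urn_model) emeasure_U:
  assumes \<omega>: "\<omega> \<in> space \<Omega>" and A: "A \<in> sets M"
  shows "emeasure (U n \<omega>) A = ennreal (measure U\<^sub>0 A + (\<Sum>i<n. measure (R (Z i \<omega>)) A))"
proof (induction n)
  case 0
  interpret U0: prob_space U\<^sub>0 using initial_prob by (simp add: space_prob_algebra)
  show ?case using \<omega> by (simp add: U_0 U0.emeasure_eq_measure)
next
  case (Suc n)
  interpret R: prob_space "R (Z n \<omega>)"
    by (rule prob_space_R[OF measurable_space[OF Z_measurable \<omega>]])
  show ?case
    using Suc by (simp add: U_Suc[OF \<omega> A] R.emeasure_eq_measure flip: ennreal_plus add: sum_nonneg add.assoc)
qed

text \<open>Taking expectations in the draw rule, with the urn content unrolled, expresses each
  marginal law through the earlier ones; no joint law remains.\<close>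

lemma (in urn_model) prob_Z:
  assumes A: "A \<in> sets M"
  shows "real (n + 1) * prob (Z n -` A \<inter> space \<Omega>) = measure U\<^sub>0 A + (\<Sum>i<n. expectation (\<lambda>\<omega>. measure (R (Z i \<omega>)) A))"
proof -
  note Z_measurable[measurable] kernel[measurable] A[measurable]
  let ?h = "\<lambda>\<omega>. (measure U\<^sub>0 A + (\<Sum>i<n. measure (R (Z i \<omega>)) A)) / real (n + 1)"
  have mU: "measure (U n \<omega>) A = measure U\<^sub>0 A + (\<Sum>i<n. measure (R (Z i \<omega>)) A)" if "\<omega> \<in> space \<Omega>" for \<omega>
    unfolding measure_def[of "U n \<omega>"] emeasure_U[OF that A] by (rule enn2real_ennreal) (simp add: sum_nonneg)
  have ae: "AE \<omega> in \<Omega>. real_cond_exp \<Omega> (past \<Omega> M Z n) (indicator (Z n -` A \<inter> space \<Omega>)) \<omega> = ?h \<omega>"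
    using draw[OF A, of n] by (rule AE_mp) (auto simp: mU)
  have int: "integrable \<Omega> (\<lambda>\<omega>. measure (R (Z i \<omega>)) A)" for i
    by (rule integrable_const_bound[where B=1])
       (auto intro!: prob_space.prob_le_1 prob_space_R measurable_space[OF Z_measurable])
  have "expectation ?h = prob (Z n -` A \<inter> space \<Omega>)"
    by (rule expectation_conditional_prob[OF Z_measurable _ _ ae]) auto
  moreover have "expectation ?h = (measure U\<^sub>0 A + (\<Sum>i<n. expectation (\<lambda>\<omega>. measure (R (Z i \<omega>)) A))) / real (n + 1)"
    using int by (simp add: prob_space)
  ultimately show ?thesis by (simp add: field_simps)
qed

lemma (in urn_model) distr_Z_0: "distr \<Omega> M (Z 0) = U\<^sub>0"
proof (rule measure_eqI)
  interpret U0: prob_space U\<^sub>0 using initial_prob by (simp add: space_prob_algebra)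
  show "sets (distr \<Omega> M (Z 0)) = sets U\<^sub>0" using initial_prob by (simp add: space_prob_algebra)
  fix A assume "A \<in> sets (distr \<Omega> M (Z 0))"
  then show "emeasure (distr \<Omega> M (Z 0)) A = emeasure U\<^sub>0 A"
    using prob_Z[of A 0] Z_measurable
    by (simp add: emeasure_distr emeasure_eq_measure U0.emeasure_eq_measure)
qed

text \<open>Subtracting the averaged identities for \<open>n\<close> and \<open>n + 1\<close> gives
  \<open>(n + 2) P(Z (n + 1) \<in> A) = (n + 1) P(Z n \<in> A) + E[R (Z n) A]\<close>. In law, the
  next draw is thus the present one, moved by one kernel step with probability
  \<open>1 / (n + 2)\<close>.\<close>

lemma (in urn_model) distr_Z_Suc:
  "distr \<Omega> M (Z (Suc n)) = measure_pmf (bernoulli_pmf (1 / real (n + 2))) \<bind>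
     (\<lambda>c. if c then distr \<Omega> M (Z n) \<bind> R else distr \<Omega> M (Z n))"
proof (rule measure_eqI)
  note Z_measurable[measurable] kernel[measurable]
  let ?D = "distr \<Omega> M (Z n)"
  let ?B = "\<lambda>c. if c then ?D \<bind> R else ?D"
  have D: "?D \<in> space (prob_algebra M)"
    by (simp add: space_prob_algebra prob_space_distr)
  have DR: "?D \<bind> R \<in> space (prob_algebra M)"
    using D by (auto simp: space_prob_algebra prob_space_bind'[OF D kernel] sets_bind'[OF D kernel])
  have B: "?B \<in> count_space UNIV \<rightarrow>\<^sub>M prob_algebra M"
    using D DR by auto
  have pmf: "measure_pmf (bernoulli_pmf p) \<in> space (prob_algebra (count_space UNIV))" for p
    by (simp add: space_prob_algebra measure_pmf.prob_space_axioms)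
  show "sets (distr \<Omega> M (Z (Suc n))) = sets (measure_pmf (bernoulli_pmf (1 / real (n + 2))) \<bind> ?B)"
    by (subst sets_bind'[OF pmf B]) simp
  fix A assume "A \<in> sets (distr \<Omega> M (Z (Suc n)))"
  then have A[measurable]: "A \<in> sets M" by simp
  have R1: "emeasure (R (Z n \<omega>)) A = ennreal (measure (R (Z n \<omega>)) A)"
    and R2: "measure (R (Z n \<omega>)) A \<le> 1" if "\<omega> \<in> space \<Omega>" for \<omega>
  proof -
    interpret R: prob_space "R (Z n \<omega>)"
      by (rule prob_space_R[OF measurable_space[OF Z_measurable that]])
    show "emeasure (R (Z n \<omega>)) A = ennreal (measure (R (Z n \<omega>)) A)" by (rule R.emeasure_eq_measure)
    show "measure (R (Z n \<omega>)) A \<le> 1" by (rule R.prob_le_1)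
  qed
  let ?e = "expectation (\<lambda>\<omega>. measure (R (Z n \<omega>)) A)" and ?p = "\<lambda>n. prob (Z n -` A \<inter> space \<Omega>)"
  have "emeasure (?D \<bind> R) A = (\<integral>\<^sup>+\<omega>. emeasure (R (Z n \<omega>)) A \<partial>\<Omega>)"
    unfolding emeasure_bind_prob_algebra[OF D kernel A]
    using measurable_prob_algebraD[OF kernel] by (subst nn_integral_distr) auto
  also have "\<dots> = (\<integral>\<^sup>+\<omega>. ennreal (measure (R (Z n \<omega>)) A) \<partial>\<Omega>)"
    by (intro nn_integral_cong R1)
  also have "\<dots> = ennreal ?e"
    by (intro nn_integral_eq_integral integrable_const_bound[where B=1]) (auto simp: R2)
  finally have DRA: "emeasure (?D \<bind> R) A = ennreal ?e" .
  have DA: "emeasure (distr \<Omega> M (Z m)) A = ennreal (?p m)" for m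
    by (simp add: emeasure_distr emeasure_eq_measure)
  have "real (n + 2) * ?p (Suc n) = real (n + 1) * ?p n + ?e"
    using prob_Z[OF A, of n] prob_Z[OF A, of "Suc n"] by simp
  then have "?p (Suc n) = (real (n + 1) * ?p n + ?e) / real (n + 2)"
    by (simp add: eq_divide_eq mult.commute)
  also have "\<dots> = ?e * (1 / real (n + 2)) + ?p n * (1 - 1 / real (n + 2))"
  proof -
    have "1 - 1 / real (n + 2) = real (n + 1) / real (n + 2)" by (simp add: field_simps)
    then show ?thesis by (simp only: add_divide_distrib) (simp add: mult.commute)
  qed
  finally have p: "?p (Suc n) = ?e * (1 / real (n + 2)) + ?p n * (1 - 1 / real (n + 2))" .
  have e0: "0 \<le> ?e" by (intro integral_nonneg_AE) auto
  have "emeasure (measure_pmf (bernoulli_pmf (1 / real (n + 2))) \<bind> ?B) A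
      = (\<integral>\<^sup>+c. emeasure (?B c) A \<partial>measure_pmf (bernoulli_pmf (1 / real (n + 2))))"
    by (rule emeasure_bind_prob_algebra[OF pmf B A])
  also have "\<dots> = ennreal ?e * ennreal (1 / real (n + 2)) + ennreal (?p n) * ennreal (1 - 1 / real (n + 2))"
    by (subst nn_integral_bernoulli_pmf) (auto simp: DRA DA)
  also have "\<dots> = ennreal (?p (Suc n))"
  proof -
    have "0 \<le> 1 / real (n + 2)" "0 \<le> 1 - 1 / real (n + 2)" by auto
    then show ?thesis
      unfolding p using e0 by (simp only: ennreal_plus ennreal_mult mult_nonneg_nonneg measure_nonneg)
  qed
  also have "\<dots> = emeasure (distr \<Omega> M (Z (Suc n))) A" by (simp add: DA)
  finally show "emeasure (distr \<Omega> M (Z (Suc n))) A = emeasure (measure_pmf (bernoulli_pmf (1 / real (n + 2))) \<bind> ?B) A" ..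
qed

text \<open>By induction: a further kernel step shifts the index of \<open>\<nu>\<close> by one, and
  the new coin in \<open>draw_count\<close> decides whether the shift takes place.\<close>

lemma (in urn_model) distr_Z_mixture:
  assumes \<nu>_0: "\<nu> 0 = U\<^sub>0" and \<nu>_Suc: "\<And>k. \<nu> (Suc k) = \<nu> k \<bind> R"
  shows "distr \<Omega> M (Z n) = measure_pmf (draw_count n) \<bind> \<nu>"
proof (induction n)
  have \<nu>: "\<nu> k \<in> space (prob_algebra M)" for k
  proof (induction k)
    case (Suc k)
    then show ?case
      using prob_space_bind'[OF Suc kernel] sets_bind'[OF Suc kernel] by (simp add: \<nu>_Suc space_prob_algebra)
  qed (simp add: \<nu>_0 initial_prob)
  have pmf: "measure_pmf p \<in> space (prob_algebra (count_space UNIV))" for p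
    by (simp add: space_prob_algebra measure_pmf.prob_space_axioms)
  have sub: "\<nu> \<in> measure_pmf p \<rightarrow>\<^sub>M subprob_algebra M" for p
    using \<nu> measurable_prob_algebraD[of \<nu> "count_space UNIV" M] by simp
  {
    case 0
    show ?case
      using bind_return[of \<nu> "count_space UNIV" M 0] sub[of "return_pmf 0"]
      by (simp add: distr_Z_0 \<nu>_0 return_pmf.rep_eq)
  next
    case (Suc n)
    let ?W = "measure_pmf (draw_count n)"
    have 1: "distr \<Omega> M (Z n) \<bind> R = ?W \<bind> (\<lambda>k. \<nu> (k + 1))"
      unfolding Suc using bind_assoc[OF sub measurable_prob_algebraD[OF kernel], of "draw_count n"]
      by (simp add: \<nu>_Suc)
    have 2: "measure_pmf (map_pmf (\<lambda>k. k + j) (draw_count n)) \<bind> \<nu> = ?W \<bind> (\<lambda>k. \<nu> (k + j))" for j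
      unfolding map_pmf_rep_eq
      by (subst bind_distr[where K=M]) (use sub in \<open>auto\<close>)
    have "distr \<Omega> M (Z (Suc n)) = measure_pmf (bernoulli_pmf (1 / real (n + 2))) \<bind>
       (\<lambda>c. measure_pmf (map_pmf (\<lambda>k. k + of_bool c) (draw_count n)) \<bind> \<nu>)"
      unfolding distr_Z_Suc
      by (rule bind_cong[OF refl]) (auto simp: 1[unfolded Suc, simplified] 2 Suc)
    also have "\<dots> = measure_pmf (draw_count (Suc n)) \<bind> \<nu>"
      unfolding draw_count.simps measure_pmf_bind
      by (rule bind_assoc[symmetric, where N="count_space UNIV" and R=M]) (use sub[of "return_pmf 0"] in \<open>auto simp: measure_pmf_in_subprob_algebra\<close>)
    finally show ?case .
  }
qed

section \<open>Regular variation\<close>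

text \<open>The sequential, additive form of the uniform convergence theorem for slowly varying
  functions: from fixed shifts to shifts \<open>u n\<close> that vary with \<open>n\<close>.\<close>

lemma asymptotically_translation_invariant_uniform:
  fixes g :: "real \<Rightarrow> real" and x u :: "nat \<Rightarrow> real"
  assumes g[measurable]: "g \<in> borel_measurable borel"
    and lim: "\<And>u. ((\<lambda>x. g (x + u) - g x) \<longlongrightarrow> 0) at_top"
    and x: "filterlim x at_top sequentially" and u: "u \<longlonglongrightarrow> 0"
  shows "(\<lambda>n. g (x n + u n) - g (x n)) \<longlonglongrightarrow> 0"
proof -
  \<comment> \<open>Both \<open>g (x n)\<close> and \<open>g (x n + u n)\<close> are close in mean to \<open>g (x n + w)\<close>, \<open>w\<close> ranging over a unit
    interval starting at \<open>0\<close> and \<open>u n\<close> respectively; these intervals overlap.\<close>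
  define \<phi> :: "real \<Rightarrow> real" where "\<phi> r = min 1 \<bar>r\<bar>" for r
  have [measurable]: "\<phi> \<in> borel_measurable borel" unfolding \<phi>_def by measurable
  have \<phi>0: "0 \<le> \<phi> r" and \<phi>1: "\<phi> r \<le> 1" for r by (auto simp: \<phi>_def)
  \<comment> \<open>Truncation at \<open>1\<close> makes dominated convergence available without any
    bound on \<open>g\<close>, and keeps the triangle inequality.\<close>
  have \<phi>_tri: "\<phi> (p - q) \<le> \<phi> (r - q) + \<phi> (r - p)" for p q r by (auto simp: \<phi>_def)
  have \<phi>_tendsto: "((\<lambda>n. \<phi> (w n)) \<longlongrightarrow> 0) F" if "(w \<longlongrightarrow> 0) F" for w and F :: "nat filter"
  proof -
    have "((\<lambda>n. min 1 \<bar>w n\<bar>) \<longlongrightarrow> min 1 \<bar>0\<bar>) F"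
      by (intro tendsto_min tendsto_const tendsto_rabs that)
    then show ?thesis by (simp add: \<phi>_def)
  qed
  have A: "(\<lambda>n. \<integral>w. indicator {0..1} w * \<phi> (g (y n + w) - g (y n)) \<partial>lborel) \<longlonglongrightarrow> 0"
    if y: "filterlim y at_top sequentially" for y
  proof -
    have "(\<lambda>n. \<integral>w. indicator {0..1} w * \<phi> (g (y n + w) - g (y n)) \<partial>lborel) \<longlonglongrightarrow> (\<integral>w. 0 \<partial>(lborel :: real measure))"
    proof (rule integral_dominated_convergence[where w="indicator {0..1}"])
      show "AE w in lborel. (\<lambda>n. indicator {0..1} w * \<phi> (g (y n + w) - g (y n))) \<longlonglongrightarrow> 0"
      proof (rule AE_I2)
        fix w :: real
        have "(\<lambda>n. g (y n + w) - g (y n)) \<longlonglongrightarrow> 0"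
          using filterlim_compose[OF lim y] .
        from tendsto_mult_right_zero[OF \<phi>_tendsto[OF this]]
        show "(\<lambda>n. indicator {0..1} w * \<phi> (g (y n + w) - g (y n))) \<longlonglongrightarrow> 0" .
      qed
    qed (auto simp: \<phi>0 \<phi>1 split: split_indicator)
    then show ?thesis by simp
  qed
  let ?A = "\<lambda>n. \<integral>w. indicator {0..1} w * \<phi> (g (x n + w) - g (x n)) \<partial>lborel"
  let ?B = "\<lambda>n. \<integral>w. indicator {0..1} w * \<phi> (g (x n + u n + w) - g (x n + u n)) \<partial>lborel"
  have xu: "filterlim (\<lambda>n. x n + u n) at_top sequentially"
    using filterlim_tendsto_add_at_top[OF u x] by (simp add: add.commute)
  have AB: "(\<lambda>n. 2 * (?A n + ?B n)) \<longlonglongrightarrow> 0"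
    using tendsto_mult_right_zero[OF tendsto_add_zero[OF A[OF x] A[OF xu]]] .
  have "eventually (\<lambda>n. \<bar>u n\<bar> < 1/4) sequentially"
    using u[THEN tendstoD, of "1/4"] by (simp add: dist_real_def)
  then have le: "eventually (\<lambda>n. \<phi> (g (x n + u n) - g (x n)) \<le> 2 * (?A n + ?B n)) sequentially"
  proof eventually_elim
    case (elim n)
    let ?p = "g (x n + u n)" and ?q = "g (x n)"
    have int: "integrable lborel (\<lambda>w. indicator {a..b} w * \<phi> (h w) :: real)"
      if [measurable]: "h \<in> borel_measurable borel" for h and a b :: real
      by (rule Bochner_Integration.integrable_bound[of _ "indicator {a..b} :: real \<Rightarrow> real"])
         (auto simp: \<phi>0 \<phi>1 integrable_indicator_iff emeasure_lborel_Icc_eq split: split_indicator)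
    have "?B n = (\<integral>w. indicator {0..1} (w - u n) * \<phi> (g (x n + w) - ?p) \<partial>lborel)"
      by (subst lborel_integral_real_affine[where c=1 and t="u n"]) (auto simp: algebra_simps)
    also have "\<dots> = (\<integral>w. indicator {u n..1 + u n} w * \<phi> (g (x n + w) - ?p) \<partial>lborel)"
      by (intro Bochner_Integration.integral_cong) (auto split: split_indicator)
    finally have B: "?B n = \<dots>" .
    \<comment> \<open>For \<open>\<bar>u n\<bar> < 1/4\<close> both unit intervals contain
      \<open>[1/4, 3/4]\<close>. There the triangle inequality through \<open>g (x n + w)\<close>
      applies, and the length \<open>1/2\<close> accounts for the factor \<open>2\<close>.\<close>
    have "(1/2) * \<phi> (?p - ?q) = (\<integral>w. indicator {1/4..3/4} w * \<phi> (?p - ?q) \<partial>(lborel::real measure))"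
      by simp
    also have "\<dots> \<le> (\<integral>w. indicator {0..1} w * \<phi> (g (x n + w) - ?q) + indicator {u n..1 + u n} w * \<phi> (g (x n + w) - ?p) \<partial>lborel)"
      using elim
      by (intro integral_mono Bochner_Integration.integrable_add int)
         (auto split: split_indicator simp: \<phi>0 \<phi>_tri)
    also have "\<dots> = ?A n + ?B n"
      unfolding B by (intro Bochner_Integration.integral_add int) auto
    finally show ?case by simp
  qed
  have lim0: "(\<lambda>n. \<phi> (g (x n + u n) - g (x n))) \<longlonglongrightarrow> 0"
    by (rule tendsto_sandwich[OF _ le tendsto_const AB]) (simp add: \<phi>0)
  show ?thesis
  proof (rule tendstoI)
    fix e :: real assume "e > 0"
    with lim0[THEN tendstoD, of "min 1 e"]
    show "eventually (\<lambda>n. dist (g (x n + u n) - g (x n)) 0 < e) sequentially"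
      by (auto simp: dist_real_def \<phi>_def elim!: eventually_mono split: if_splits)
  qed
qed

text \<open>In logarithmic coordinates, and with the linear term \<open>\<rho> * t\<close> removed,
  regular variation becomes asymptotic translation invariance of \<open>g\<close>. The ratio of
  arguments then appears as the vanishing shift \<open>ln (y n / x n)\<close>.\<close>

lemma regularly_varying_ratio_tendsto_1:
  assumes b: "regularly_varying b" and x: "filterlim x at_top sequentially"
    and xy: "(\<lambda>n. y n / x n) \<longlonglongrightarrow> 1"
  shows "(\<lambda>n. b (y n) / b (x n)) \<longlonglongrightarrow> 1"
proof -
  have meas: "b \<in> borel_measurable (restrict_space borel {0..})"
    and pos: "eventually (\<lambda>x. b x > 0) at_top" using b by (auto simp: regularly_varying_def)
  obtain \<rho> where \<rho>: "\<And>c. c > 0 \<Longrightarrow> ((\<lambda>x. b (c * x) / b x) \<longlongrightarrow> c powr \<rho>) at_top"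
    using b by (auto simp: regularly_varying_def)
  define g where "g t = ln (b (exp t)) - \<rho> * t" for t
  have "(\<lambda>t. b (exp t)) \<in> borel_measurable borel"
    by (rule measurable_compose[OF _ meas]) (auto intro!: measurable_restrict_space2)
  then have g_meas: "g \<in> borel_measurable borel" unfolding g_def by measurable
  have pos_exp: "eventually (\<lambda>t. b (exp t) > 0) at_top"
    using pos exp_at_top by (rule eventually_compose_filterlim)
  have g_lim: "((\<lambda>t. g (t + u) - g t) \<longlongrightarrow> 0) at_top" for u
  proof -
    have tu: "filterlim (\<lambda>t. t + u) at_top at_top"
      using filterlim_tendsto_add_at_top[OF tendsto_const[of u] filterlim_ident] by (subst add.commute)
    have "((\<lambda>t. ln (b (exp u * exp t) / b (exp t))) \<longlongrightarrow> ln (exp u powr \<rho>)) at_top"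
      by (intro tendsto_ln filterlim_compose[OF \<rho> exp_at_top]) auto
    then have "((\<lambda>t. ln (b (exp u * exp t) / b (exp t)) - \<rho> * u) \<longlongrightarrow> 0) at_top"
      by (simp add: ln_powr LIM_zero_iff)
    then show ?thesis
    proof (rule Lim_transform_eventually)
      show "eventually (\<lambda>t. ln (b (exp u * exp t) / b (exp t)) - \<rho> * u = g (t + u) - g t) at_top"
        using pos_exp eventually_compose_filterlim[OF pos_exp tu]
        by eventually_elim (simp add: g_def ln_div exp_add algebra_simps)
    qed
  qed
  have xpos: "eventually (\<lambda>n. x n > 0) sequentially"
    using x by (simp add: filterlim_at_top_dense)
  have rpos: "eventually (\<lambda>n. y n / x n > 0) sequentially"
    using xy by (rule order_tendstoD) simp
  have y: "filterlim y at_top sequentially"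
  proof -
    have "filterlim (\<lambda>n. (y n / x n) * x n) at_top sequentially"
      by (rule filterlim_tendsto_pos_mult_at_top[OF xy _ x]) simp
    then show ?thesis
      by (rule filterlim_mono_eventually[OF _ order_refl order_refl])
         (use xpos in eventually_elim, simp)
  qed
  have lx: "filterlim (\<lambda>n. ln (x n)) at_top sequentially"
    using filterlim_compose[OF ln_at_top x] .
  have u0: "(\<lambda>n. ln (y n / x n)) \<longlonglongrightarrow> 0"
    using tendsto_ln[OF xy] by simp
  have "(\<lambda>n. (g (ln (x n) + ln (y n / x n)) - g (ln (x n))) + \<rho> * ln (y n / x n)) \<longlonglongrightarrow> 0 + \<rho> * 0"
    by (intro tendsto_intros u0 asymptotically_translation_invariant_uniform[OF g_meas g_lim lx])
  then have "(\<lambda>n. exp ((g (ln (x n) + ln (y n / x n)) - g (ln (x n))) + \<rho> * ln (y n / x n))) \<longlonglongrightarrow> exp (0 + \<rho> * 0)"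
    by (rule tendsto_exp)
  then have "(\<lambda>n. exp ((g (ln (x n) + ln (y n / x n)) - g (ln (x n))) + \<rho> * ln (y n / x n))) \<longlonglongrightarrow> 1"
    by simp
  then show ?thesis
  proof (rule Lim_transform_eventually)
    show "eventually (\<lambda>n. exp ((g (ln (x n) + ln (y n / x n)) - g (ln (x n))) + \<rho> * ln (y n / x n)) = b (y n) / b (x n)) sequentially"
      using xpos rpos eventually_compose_filterlim[OF pos x] eventually_compose_filterlim[OF pos y]
    proof eventually_elim
      case (elim n)
      then have "y n > 0" by (simp add: zero_less_divide_iff)
      with elim show ?case
        by (simp add: g_def ln_div exp_diff algebra_simps)
    qed
  qed
qed

section \<open>Weak convergence with affine perturbations\<close>

text \<open>On a large ball the integrands are uniformly close. Outside it their difference is at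
  most \<open>2 * B\<close>, and the mass there is dominated by the integral of a continuous cutoff,
  which weak convergence controls through \<open>\<Lambda>\<close>.\<close>

lemma weakly_converges_varying_integrand:
  fixes h :: "'b::euclidean_space \<Rightarrow> real"
  assumes conv: "weakly_converges \<mu> \<Lambda>"
    and \<mu>: "\<And>n. prob_space (\<mu> n)" "\<And>n. sets (\<mu> n) = sets borel"
    and \<Lambda>: "prob_space \<Lambda>" "sets \<Lambda> = sets borel"
    and k: "filterlim k at_top sequentially"
    and hn: "\<And>n. hn n \<in> borel_measurable borel" "\<And>n y. \<bar>hn n y\<bar> \<le> B"
    and h: "continuous_on UNIV h" "\<And>y. \<bar>h y\<bar> \<le> B"
    and unif: "\<And>r e. e > 0 \<Longrightarrow> eventually (\<lambda>n. \<forall>y\<in>cball 0 r. \<bar>hn n y - h y\<bar> \<le> e) sequentially"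
  shows "(\<lambda>n. \<integral>y. hn n y \<partial>\<mu> (k n)) \<longlonglongrightarrow> (\<integral>y. h y \<partial>\<Lambda>)"
proof -
  interpret \<mu>: prob_space "\<mu> n" for n by (rule \<mu>)
  interpret \<Lambda>: prob_space \<Lambda> by (rule \<Lambda>)
  note \<mu>(2)[measurable_cong] \<Lambda>(2)[measurable_cong] hn(1)[measurable]
  have [measurable]: "h \<in> borel_measurable borel"
    by (rule borel_measurable_continuous_onI[OF h(1)])
  have B: "B \<ge> 0" using h(2)[of 0] by linarith
  have weak: "(\<lambda>n. \<integral>x. f x \<partial>\<mu> (k n)) \<longlonglongrightarrow> (\<integral>x. f x \<partial>\<Lambda>)"
    if "continuous_on UNIV f" "\<And>y. \<bar>f y\<bar> \<le> C" for f and C :: real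
    using conv that k unfolding weakly_converges_def
    by (intro filterlim_compose[of "\<lambda>n. \<integral>x. f x \<partial>\<mu> n" _ at_top k]) (auto simp: bounded_iff)
  \<comment> \<open>A continuous substitute for the indicator of the complement of a ball:
    \<open>0\<close> up to radius \<open>r\<close>, \<open>1\<close> from radius
    \<open>r + 1\<close> on.\<close>
  define cut :: "real \<Rightarrow> 'b \<Rightarrow> real" where "cut r y = min 1 (max 0 (norm y - r))" for r y
  have cut_cont: "continuous_on UNIV (cut r)" for r
    unfolding cut_def by (intro continuous_intros)
  have cut_bound: "0 \<le> cut r y" "cut r y \<le> 1" for r y by (auto simp: cut_def)
  have [measurable]: "cut r \<in> borel_measurable borel" for r
    by (rule borel_measurable_continuous_onI[OF cut_cont])
  have "(\<lambda>m. \<integral>y. cut (real m) y \<partial>\<Lambda>) \<longlonglongrightarrow> (\<integral>y. 0 \<partial>\<Lambda>)"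
  proof (rule integral_dominated_convergence[where w="\<lambda>_. 1"])
    show "AE y in \<Lambda>. (\<lambda>m. cut (real m) y) \<longlonglongrightarrow> 0"
    proof (rule AE_I2)
      fix y :: 'b
      have "eventually (\<lambda>m. cut (real m) y = 0) sequentially"
        using eventually_ge_at_top[of "nat \<lceil>norm y\<rceil>"]
        by eventually_elim (auto simp: cut_def)
      then show "(\<lambda>m. cut (real m) y) \<longlonglongrightarrow> 0" by (rule tendsto_eventually)
    qed
  qed (auto simp: cut_bound)
  then have cut_lim: "(\<lambda>m. \<integral>y. cut (real m) y \<partial>\<Lambda>) \<longlonglongrightarrow> 0" by simp
  have "(\<lambda>n. (\<integral>y. hn n y \<partial>\<mu> (k n)) - (\<integral>y. h y \<partial>\<mu> (k n))) \<longlonglongrightarrow> 0"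
  proof (rule tendstoI)
    fix e :: real assume e: "e > 0"
    \<comment> \<open>Chosen so that \<open>2 * B * d \<le> e / 2\<close>; the summand
      \<open>1\<close> covers \<open>B = 0\<close>.\<close>
    define d where "d = e / (4 * (B + 1))"
    have d: "d > 0" using e B by (simp add: d_def)
    obtain m where m: "(\<integral>y. cut (real m) y \<partial>\<Lambda>) < d"
      using order_tendstoD(2)[OF cut_lim d] by (auto simp: eventually_sequentially)
    have "(\<lambda>n. \<integral>y. cut (real m) y \<partial>\<mu> (k n)) \<longlonglongrightarrow> (\<integral>y. cut (real m) y \<partial>\<Lambda>)"
      by (rule weak[OF cut_cont, of _ 1]) (use cut_bound in \<open>auto simp: abs_le_iff intro: order_trans[of _ 0]\<close>)
    from order_tendstoD(2)[OF this m]
    have ev1: "eventually (\<lambda>n. (\<integral>y. cut (real m) y \<partial>\<mu> (k n)) < d) sequentially" .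
    have "e / 4 > 0" using e by simp
    from ev1 unif[OF this, of "real m + 1"]
    show "eventually (\<lambda>n. dist ((\<integral>y. hn n y \<partial>\<mu> (k n)) - (\<integral>y. h y \<partial>\<mu> (k n))) 0 < e) sequentially"
    proof eventually_elim
      case (elim n)
      have int[simp]: "integrable (\<mu> (k n)) (hn n)" "integrable (\<mu> (k n)) h" "integrable (\<mu> (k n)) (cut (real m))"
        using hn(2) h(2) cut_bound
        by (auto intro!: \<mu>.integrable_const_bound[where B="max B 1"] simp: le_max_iff_disj)
      have "\<bar>(\<integral>y. hn n y \<partial>\<mu> (k n)) - (\<integral>y. h y \<partial>\<mu> (k n))\<bar> = \<bar>\<integral>y. hn n y - h y \<partial>\<mu> (k n)\<bar>"
        by simp
      also have "\<dots> \<le> (\<integral>y. \<bar>hn n y - h y\<bar> \<partial>\<mu> (k n))"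
        by (rule integral_abs_bound)
      also have "\<dots> \<le> (\<integral>y. e / 4 + 2 * B * cut (real m) y \<partial>\<mu> (k n))"
      proof (rule integral_mono)
        fix y
        show "\<bar>hn n y - h y\<bar> \<le> e / 4 + 2 * B * cut (real m) y"
        proof (cases "norm y \<le> real m + 1")
          case True
          then have "\<bar>hn n y - h y\<bar> \<le> e / 4" using elim(2) by auto
          moreover have "0 \<le> 2 * B * cut (real m) y" using B cut_bound by simp
          ultimately show ?thesis by linarith
        next
          case False
          then have "cut (real m) y = 1" by (simp add: cut_def)
          moreover have "\<bar>hn n y - h y\<bar> \<le> 2 * B" using hn(2)[of n y] h(2)[of y] by linarith
          ultimately show ?thesis using e by simp
        qed
      qed auto
      also have "\<dots> = e / 4 + 2 * B * (\<integral>y. cut (real m) y \<partial>\<mu> (k n))"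
        by (subst Bochner_Integration.integral_add) (auto simp: \<mu>.prob_space)
      also have "\<dots> \<le> e / 4 + 2 * B * d"
        using elim(1) B by (intro add_left_mono mult_left_mono) auto
      also have "2 * B * d \<le> e / 2"
        using B e by (simp add: d_def field_simps)
      also have "e / 4 + e / 2 < e" using e by simp
      finally show ?case by (simp add: dist_real_def)
    qed
  qed
  from tendsto_add[OF this weak[OF h(1,2)]] show ?thesis by simp
qed

text \<open>A Slutsky argument: the affine maps converge uniformly on balls, and \<open>f\<close> is
  uniformly continuous on compact sets.\<close>

lemma weakly_converges_affine:
  fixes f :: "'b::euclidean_space \<Rightarrow> real"
  assumes conv: "weakly_converges \<mu> \<Lambda>"
    and \<mu>: "\<And>n. prob_space (\<mu> n)" "\<And>n. sets (\<mu> n) = sets borel"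
    and \<Lambda>: "prob_space \<Lambda>" "sets \<Lambda> = sets borel"
    and k: "filterlim k at_top sequentially"
    and f: "continuous_on UNIV f" "\<And>y. \<bar>f y\<bar> \<le> B"
    and c: "c \<longlonglongrightarrow> 1" and d: "d \<longlonglongrightarrow> d0"
  shows "(\<lambda>n. \<integral>y. f (c n *\<^sub>R y + d n) \<partial>\<mu> (k n)) \<longlonglongrightarrow> (\<integral>y. f (y + d0) \<partial>\<Lambda>)"
proof (rule weakly_converges_varying_integrand[OF conv \<mu> \<Lambda> k, where B=B])
  have f_comp: "continuous_on UNIV (\<lambda>y. f (a *\<^sub>R y + b))" for a b
    by (rule continuous_on_compose2[OF f(1)]) (auto intro!: continuous_intros)
  from f_comp[of 1 d0] show "continuous_on UNIV (\<lambda>y. f (y + d0))" by simp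
  show "(\<lambda>y. f (c n *\<^sub>R y + d n)) \<in> borel_measurable borel" for n
    by (rule borel_measurable_continuous_onI[OF f_comp])
  fix r e :: real assume e: "e > 0"
  \<comment> \<open>A radius for which the ball contains the limit point \<open>y + d0\<close> and
    every point within distance \<open>1\<close> of it; hence \<open>min \<delta> 1\<close>
    below.\<close>
  define s where "s = \<bar>r\<bar> + norm d0 + 1"
  have "uniformly_continuous_on (cball 0 s) f"
    by (rule compact_uniformly_continuous) (auto intro: continuous_on_subset[OF f(1)])
  then obtain \<delta> where \<delta>: "\<delta> > 0" "\<And>x y. x \<in> cball 0 s \<Longrightarrow> y \<in> cball 0 s \<Longrightarrow> dist y x < \<delta> \<Longrightarrow> dist (f y) (f x) < e"
    using e unfolding uniformly_continuous_on_def by metis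
  have "(\<lambda>n. \<bar>c n - 1\<bar> * \<bar>r\<bar> + norm (d n - d0)) \<longlonglongrightarrow> \<bar>1 - 1\<bar> * \<bar>r\<bar> + norm (d0 - d0)"
    by (intro tendsto_intros c d)
  then have "(\<lambda>n. \<bar>c n - 1\<bar> * \<bar>r\<bar> + norm (d n - d0)) \<longlonglongrightarrow> 0" by simp
  moreover have "min \<delta> 1 > 0" using \<delta> by simp
  ultimately have "eventually (\<lambda>n. \<bar>c n - 1\<bar> * \<bar>r\<bar> + norm (d n - d0) < min \<delta> 1) sequentially"
    by (rule order_tendstoD(2))
  then show "eventually (\<lambda>n. \<forall>y\<in>cball 0 r. \<bar>f (c n *\<^sub>R y + d n) - f (y + d0)\<bar> \<le> e) sequentially"
  proof eventually_elim
    case (elim n)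
    show ?case
    proof
      fix y :: 'b assume "y \<in> cball 0 r"
      then have y: "norm y \<le> \<bar>r\<bar>" by simp
      have "dist (c n *\<^sub>R y + d n) (y + d0) = norm ((c n - 1) *\<^sub>R y + (d n - d0))"
        by (simp add: dist_norm algebra_simps)
      also have "\<dots> \<le> \<bar>c n - 1\<bar> * norm y + norm (d n - d0)"
        by (rule order_trans[OF norm_triangle_ineq]) simp
      also have "\<dots> \<le> \<bar>c n - 1\<bar> * \<bar>r\<bar> + norm (d n - d0)"
        using y by (intro add_right_mono mult_left_mono) auto
      finally have dd: "dist (c n *\<^sub>R y + d n) (y + d0) < min \<delta> 1" using elim by linarith
      have "norm (y + d0) \<le> \<bar>r\<bar> + norm d0" using y norm_triangle_ineq[of y d0] by linarith
      moreover have "norm (c n *\<^sub>R y + d n) \<le> norm (y + d0) + 1"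
        using dd norm_triangle_ineq2[of "c n *\<^sub>R y + d n" "y + d0"] by (simp add: dist_norm)
      ultimately have "y + d0 \<in> cball 0 s" "c n *\<^sub>R y + d n \<in> cball 0 s"
        by (auto simp: s_def)
      from \<delta>(2)[OF this] dd have "dist (f (c n *\<^sub>R y + d n)) (f (y + d0)) < e" by simp
      then show "\<bar>f (c n *\<^sub>R y + d n) - f (y + d0)\<bar> \<le> e" by (simp add: dist_real_def)
    qed
  qed
qed (use f in auto)

section \<open>The scaling limit\<close>

text \<open>The common core of all regimes. The centering enters only through its increments along
  deterministic step numbers of the form \<open>ln n + t * sqrt (ln n)\<close> up to smaller order;
  \<open>\<kappa>\<close> measures how strongly the normal fluctuation of the number of steps
  displaces the limit along \<open>v\<close>.\<close>

lemma urn_scaling_limit: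
  fixes f :: "'b::euclidean_space \<Rightarrow> real" and v :: 'b and a b :: "real \<Rightarrow> real" and \<kappa> :: real
  assumes urn: "urn_model \<Omega> M R U\<^sub>0 U Z" and id_M: "(\<lambda>x. x) \<in> M \<rightarrow>\<^sub>M borel"
    and \<nu>_0: "\<nu> 0 = U\<^sub>0" and \<nu>_Suc: "\<And>k. \<nu> (Suc k) = \<nu> k \<bind> R"
    and \<nu>: "\<And>k. \<nu> k \<in> space (prob_algebra M)"
    and \<Lambda>: "prob_space \<Lambda>" "sets \<Lambda> = sets borel"
    and conv: "weakly_converges (\<lambda>k. distr (\<nu> k) borel (\<lambda>x. (x - a (real k) *\<^sub>R v) /\<^sub>R b (real k))) \<Lambda>"
    and b: "regularly_varying b"
    and a: "\<And>(k :: nat \<Rightarrow> nat) t. (\<lambda>n. (real (k n) - ln (real n)) / sqrt (ln (real n))) \<longlonglongrightarrow> t \<Longrightarrow>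
       (\<lambda>n. (a (real (k n)) - a (ln (real n))) / b (ln (real n))) \<longlonglongrightarrow> \<kappa> * t"
    and f: "continuous_on UNIV f" "\<And>y. \<bar>f y\<bar> \<le> B"
  shows "(\<lambda>n. \<integral>y. f y \<partial>distr \<Omega> borel (\<lambda>\<omega>. (Z n \<omega> - a (ln (real n)) *\<^sub>R v) /\<^sub>R b (ln (real n))))
     \<longlonglongrightarrow> (\<integral>t. \<integral>y. f (y + (\<kappa> * t) *\<^sub>R v) \<partial>\<Lambda> \<partial>std_normal_distribution)"
proof -
  interpret urn_model \<Omega> M R U\<^sub>0 U Z by (rule urn)
  interpret \<Lambda>: prob_space \<Lambda> by (rule \<Lambda>)
  have prob_\<nu>: "prob_space (\<nu> k)" and sets_\<nu>[measurable_cong]: "sets (\<nu> k) = sets M" for k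
    using \<nu>[of k] by (auto simp: space_prob_algebra)
  note Z_measurable[measurable] \<Lambda>(2)[measurable_cong]
  have [measurable]: "f \<in> borel_measurable borel" by (rule borel_measurable_continuous_onI[OF f(1)])
  have aff[measurable]: "(\<lambda>x. (x - p *\<^sub>R v) /\<^sub>R q) \<in> M \<rightarrow>\<^sub>M borel" for p q
    using measurable_compose[OF id_M, of "\<lambda>x. (x - p *\<^sub>R v) /\<^sub>R q" borel] by simp
  have B: "0 \<le> B" using f(2)[of 0] by linarith
  define l where "l n = ln (real n)" for n
  \<comment> \<open>The conditional mean given \<open>k\<close> steps, normalised at time
    \<open>l n\<close> rather than at time \<open>k\<close>.\<close>
  define G where "G n k = (\<integral>x. f ((x - a (l n) *\<^sub>R v) /\<^sub>R b (l n)) \<partial>\<nu> k)" for n k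
  have G_bound: "\<bar>G n k\<bar> \<le> B" for n k
  proof -
    interpret \<nu>: prob_space "\<nu> k" by (rule prob_\<nu>)
    have "\<bar>G n k\<bar> \<le> (\<integral>x. \<bar>f ((x - a (l n) *\<^sub>R v) /\<^sub>R b (l n))\<bar> \<partial>\<nu> k)"
      unfolding G_def by (rule integral_abs_bound)
    also have "\<dots> \<le> (\<integral>x. B \<partial>\<nu> k)"
      using f(2) B by (intro integral_mono \<nu>.integrable_const_bound[where B=B]) auto
    finally show ?thesis by (simp add: \<nu>.prob_space)
  qed
  have l: "filterlim l at_top sequentially"
    unfolding l_def by (rule filterlim_compose[OF ln_at_top filterlim_real_sequentially])
  have l_pos: "eventually (\<lambda>n. l n > 0) sequentially"
    using l by (simp add: filterlim_at_top_dense)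
  have sqrt_l: "filterlim (\<lambda>n. sqrt (l n)) at_top sequentially"
    by (rule filterlim_compose[OF sqrt_at_top l])
  have b_pos: "eventually (\<lambda>x. b x > 0) at_top" using b by (simp add: regularly_varying_def)

  have mix: "(\<integral>y. f y \<partial>distr \<Omega> borel (\<lambda>\<omega>. (Z n \<omega> - a (l n) *\<^sub>R v) /\<^sub>R b (l n)))
      = measure_pmf.expectation (draw_count n) (G n)" for n
  proof -
    have "(\<integral>y. f y \<partial>distr \<Omega> borel (\<lambda>\<omega>. (Z n \<omega> - a (l n) *\<^sub>R v) /\<^sub>R b (l n)))
       = (\<integral>x. f ((x - a (l n) *\<^sub>R v) /\<^sub>R b (l n)) \<partial>distr \<Omega> M (Z n))"
      using measurable_compose[OF Z_measurable aff] by (simp add: integral_distr)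
    also have "\<dots> = (\<integral>x. f ((x - a (l n) *\<^sub>R v) /\<^sub>R b (l n)) \<partial>(measure_pmf (draw_count n) \<bind> \<nu>))"
      by (simp only: distr_Z_mixture[OF \<nu>_0 \<nu>_Suc])
    also have "\<dots> = measure_pmf.expectation (draw_count n) (G n)"
      unfolding G_def
    proof (rule integral_bind[where K=M and B=B and B'=1])
      show "\<nu> \<in> measure_pmf (draw_count n) \<rightarrow>\<^sub>M subprob_algebra M"
        using \<nu> measurable_prob_algebraD[of \<nu> "count_space UNIV" M] by simp
      show "finite_measure (measure_pmf (draw_count n))" by unfold_locales
    qed (use f(2) prob_space.emeasure_space_1[OF prob_\<nu>] in auto)
    finally show ?thesis .
  qed

  have G_lim: "(\<lambda>n. G n (k n)) \<longlonglongrightarrow> (\<integral>y. f (y + (\<kappa> * t) *\<^sub>R v) \<partial>\<Lambda>)"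
    if k: "(\<lambda>n. (real (k n) - l n) / sqrt (l n)) \<longlonglongrightarrow> t" for k :: "nat \<Rightarrow> nat" and t
  proof -
    have "(\<lambda>n. 1 + (real (k n) - l n) / sqrt (l n) / sqrt (l n)) \<longlonglongrightarrow> 1 + 0"
      by (intro tendsto_add tendsto_const real_tendsto_divide_at_top[OF k sqrt_l])
    then have ratio: "(\<lambda>n. real (k n) / l n) \<longlonglongrightarrow> 1"
    proof (rule Lim_transform_eventually[OF tendsto_eq_rhs])
      show "eventually (\<lambda>n. 1 + (real (k n) - l n) / sqrt (l n) / sqrt (l n) = real (k n) / l n) sequentially"
        using l_pos by eventually_elim (simp add: diff_divide_distrib)
    qed simp
    have "filterlim (\<lambda>n. real (k n) / l n * l n) at_top sequentially"
      by (rule filterlim_tendsto_pos_mult_at_top[OF ratio _ l]) simp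
    then have rk: "filterlim (\<lambda>n. real (k n)) at_top sequentially"
      by (rule filterlim_mono_eventually[OF _ order_refl order_refl])
         (use l_pos in eventually_elim, simp)
    then have k_top: "filterlim k at_top sequentially"
      by (simp add: filterlim_sequentially_iff_filterlim_real)
    have c: "(\<lambda>n. b (real (k n)) / b (l n)) \<longlonglongrightarrow> 1"
      by (rule regularly_varying_ratio_tendsto_1[OF b l ratio])
    have d: "(\<lambda>n. ((a (real (k n)) - a (l n)) / b (l n)) *\<^sub>R v) \<longlonglongrightarrow> (\<kappa> * t) *\<^sub>R v"
      using a[OF k[unfolded l_def]] unfolding l_def by (intro tendsto_intros)
    let ?\<mu> = "\<lambda>k. distr (\<nu> k) borel (\<lambda>x. (x - a (real k) *\<^sub>R v) /\<^sub>R b (real k))"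
    have "(\<lambda>n. \<integral>y. f ((b (real (k n)) / b (l n)) *\<^sub>R y + ((a (real (k n)) - a (l n)) / b (l n)) *\<^sub>R v) \<partial>?\<mu> (k n))
       \<longlonglongrightarrow> (\<integral>y. f (y + (\<kappa> * t) *\<^sub>R v) \<partial>\<Lambda>)"
      by (rule weakly_converges_affine[OF conv _ _ \<Lambda> k_top f c d])
         (auto intro!: prob_space.prob_space_distr[OF prob_\<nu>])
    then show ?thesis
    proof (rule Lim_transform_eventually)
      show "eventually (\<lambda>n. (\<integral>y. f ((b (real (k n)) / b (l n)) *\<^sub>R y + ((a (real (k n)) - a (l n)) / b (l n)) *\<^sub>R v) \<partial>?\<mu> (k n)) = G n (k n)) sequentially"
        using eventually_compose_filterlim[OF b_pos l] eventually_compose_filterlim[OF b_pos rk]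
      proof eventually_elim
        case (elim n)
        \<comment> \<open>Change of normalisation from time \<open>k n\<close> to time
          \<open>l n\<close>; cancelling \<open>b (k n)\<close> uses that it is nonzero.\<close>
        have "(b (real (k n)) / b (l n)) *\<^sub>R ((x - a (real (k n)) *\<^sub>R v) /\<^sub>R b (real (k n))) + ((a (real (k n)) - a (l n)) / b (l n)) *\<^sub>R v
          = (x - a (l n) *\<^sub>R v) /\<^sub>R b (l n)" for x
          using elim by (simp add: divide_inverse algebra_simps)
        then show ?case
          unfolding G_def by (subst integral_distr) auto
      qed
    qed
  qed

  let ?\<mu> = "\<lambda>n. distr (draw_count n) borel (\<lambda>k. (real k - ln (real n)) / sqrt (ln (real n)))"
  have "real_distribution (?\<mu> n)" for n
    by (rule prob_space.real_distribution_distr) (auto simp: measure_pmf.prob_space_axioms)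
  from Skorohod[OF this real_dist_normal_dist draw_count_central_limit]
  obtain P T_seq T where P: "prob_space (P :: real measure)"
    and T_seq[measurable]: "\<And>n. T_seq n \<in> borel_measurable P"
    and distr_T_seq: "\<And>n. distr P borel (T_seq n) = ?\<mu> n"
    and "T \<in> P \<rightarrow>\<^sub>M lborel" and distr_T: "distr P borel T = std_normal_distribution"
    and T_lim: "\<And>x. x \<in> space P \<Longrightarrow> (\<lambda>n. T_seq n x) \<longlonglongrightarrow> T x"
    by blast
  then have T[measurable]: "T \<in> borel_measurable P" by simp
  interpret P: prob_space P by (rule P)
  \<comment> \<open>Rounding turns the points of the Skorohod representation back into numbers of steps; it is
    exact on the lattice supporting the normalised law of \<open>draw_count n\<close>.\<close>
  define r where "r n t = nat \<lfloor>l n + t * sqrt (l n) + 1 / 2\<rfloor>" for n t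
  have r[measurable]: "r n \<in> borel \<rightarrow>\<^sub>M count_space UNIV" for n
    unfolding r_def by measurable
  have Gr[measurable]: "(\<lambda>t. G n (r n t)) \<in> borel_measurable borel" for n
    by (rule measurable_compose[OF r]) simp
  have expect: "measure_pmf.expectation (draw_count n) (G n) = (\<integral>\<omega>. G n (r n (T_seq n \<omega>)) \<partial>P)" if "l n > 0" for n
  proof -
    have r_inv: "r n ((real k - l n) / sqrt (l n)) = k" for k
    proof -
      have "l n + (real k - l n) / sqrt (l n) * sqrt (l n) + 1 / 2 = real k + 1 / 2"
        using that by simp
      also have "\<lfloor>\<dots>\<rfloor> = int k" by linarith
      finally show ?thesis by (simp add: r_def)
    qed
    have "(\<integral>\<omega>. G n (r n (T_seq n \<omega>)) \<partial>P) = (\<integral>t. G n (r n t) \<partial>?\<mu> n)"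
      unfolding distr_T_seq[symmetric] by (subst integral_distr) auto
    also have "\<dots> = measure_pmf.expectation (draw_count n) (\<lambda>k. G n (r n ((real k - l n) / sqrt (l n))))"
      unfolding l_def[symmetric] by (subst integral_distr) auto
    finally show ?thesis by (simp add: r_inv)
  qed
  have "(\<lambda>n. \<integral>\<omega>. G n (r n (T_seq n \<omega>)) \<partial>P) \<longlonglongrightarrow> (\<integral>\<omega>. (\<integral>y. f (y + (\<kappa> * T \<omega>) *\<^sub>R v) \<partial>\<Lambda>) \<partial>P)"
  proof (rule integral_dominated_convergence[where w="\<lambda>_. B"])
    show "AE \<omega> in P. (\<lambda>n. G n (r n (T_seq n \<omega>))) \<longlonglongrightarrow> (\<integral>y. f (y + (\<kappa> * T \<omega>) *\<^sub>R v) \<partial>\<Lambda>)"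
    proof (rule AE_I2, rule G_lim)
      fix \<omega> assume \<omega>: "\<omega> \<in> space P"
      let ?t = "\<lambda>n. T_seq n \<omega>"
      have t: "?t \<longlonglongrightarrow> T \<omega>" by (rule T_lim[OF \<omega>])
      \<comment> \<open>Eventually \<open>l n + ?t n * sqrt (l n)\<close> is positive, so the
        truncation at zero in \<open>nat\<close> is harmless and rounding moves the point by at most
        \<open>1\<close>, which is negligible against \<open>sqrt (l n)\<close>.\<close>
      have "(\<lambda>n. ?t n / sqrt (l n)) \<longlonglongrightarrow> 0"
        by (rule real_tendsto_divide_at_top[OF t sqrt_l])
      then have small: "eventually (\<lambda>n. ?t n / sqrt (l n) > -1) sequentially"
        by (rule order_tendstoD) simp
      have "(\<lambda>n. (real (r n (?t n)) - l n) / sqrt (l n) - ?t n) \<longlonglongrightarrow> 0"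
      proof (rule Lim_null_comparison)
        show "(\<lambda>n. 1 / sqrt (l n)) \<longlonglongrightarrow> 0"
          by (rule real_tendsto_divide_at_top[OF tendsto_const sqrt_l])
        show "eventually (\<lambda>n. norm ((real (r n (?t n)) - l n) / sqrt (l n) - ?t n) \<le> 1 / sqrt (l n)) sequentially"
          using small l_pos
        proof eventually_elim
          case (elim n)
          have "?t n * sqrt (l n) = (?t n / sqrt (l n)) * l n"
            using elim(2) by (simp add: field_simps flip: power2_eq_square)
          also have "\<dots> > - 1 * l n" using elim by (intro mult_strict_right_mono) auto
          finally have "l n + ?t n * sqrt (l n) + 1 / 2 > 0" by simp
          then have "\<bar>real (r n (?t n)) - (l n + ?t n * sqrt (l n))\<bar> \<le> 1"
            unfolding r_def by linarith
          moreover have "(real (r n (?t n)) - l n) / sqrt (l n) - ?t n = (real (r n (?t n)) - (l n + ?t n * sqrt (l n))) / sqrt (l n)"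
            using elim(2) by (simp add: field_simps)
          ultimately show ?case
            using elim(2) by (simp add: divide_right_mono)
        qed
      qed
      from tendsto_add[OF this t] show "(\<lambda>n. (real (r n (?t n)) - l n) / sqrt (l n)) \<longlonglongrightarrow> T \<omega>" by simp
    qed
  qed (use G_bound in auto)
  also have "(\<integral>\<omega>. (\<integral>y. f (y + (\<kappa> * T \<omega>) *\<^sub>R v) \<partial>\<Lambda>) \<partial>P) = (\<integral>t. \<integral>y. f (y + (\<kappa> * t) *\<^sub>R v) \<partial>\<Lambda> \<partial>std_normal_distribution)"
    unfolding distr_T[symmetric] by (subst integral_distr) auto
  finally have "(\<lambda>n. \<integral>\<omega>. G n (r n (T_seq n \<omega>)) \<partial>P) \<longlonglongrightarrow> (\<integral>t. \<integral>y. f (y + (\<kappa> * t) *\<^sub>R v) \<partial>\<Lambda> \<partial>std_normal_distribution)" .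
  then show ?thesis
    unfolding l_def[symmetric] mix
    by (rule Lim_transform_eventually) (use l_pos in eventually_elim, simp add: expect)
qed

section \<open>Increments of a differentiable centering function\<close>

lemma mean_value_min:
  fixes a :: "real \<Rightarrow> real"
  assumes "a differentiable_on {0<..}" "x > 0" "y > 0"
  shows "\<exists>\<xi>\<ge>min x y. a y - a x = deriv a \<xi> * (y - x)"
proof -
  have D: "(a has_real_derivative deriv a z) (at z)" if "z > 0" for z
    using assms(1) that
    by (auto simp: differentiable_on_def DERIV_deriv_iff_real_differentiable at_within_open[of _ "{0<..}"])
  \<comment> \<open>The case of ordered endpoints. Only a lower bound on the intermediate point is
    kept, as it must go to infinity together with both endpoints.\<close>
  have *: "\<exists>\<xi>\<ge>min x y. a y - a x = deriv a \<xi> * (y - x)" if "x < y" "x > 0" for x y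
  proof -
    have "\<exists>z>x. z < y \<and> a y - a x = (y - x) * deriv a z"
      using that by (intro MVT2) (auto intro!: D)
    then obtain z where "x < z" "z < y" "a y - a x = (y - x) * deriv a z" by blast
    then show ?thesis using that by (intro exI[of _ z]) (auto simp: mult.commute)
  qed
  consider "x < y" | "y < x" | "x = y" by linarith
  then show ?thesis
  proof cases
    case 2
    from *[OF this assms(3)] obtain \<xi> where "\<xi> \<ge> min y x" "a x - a y = deriv a \<xi> * (x - y)" by blast
    then show ?thesis by (intro exI[of _ \<xi>]) (auto simp: algebra_simps)
  qed (use * assms in auto)
qed

text \<open>By the mean value theorem the quotient factors as \<open>deriv a (\<xi> n)\<close> times
  \<open>sqrt (l n) / b (l n)\<close> times \<open>(k n - l n) / sqrt (l n)\<close>, and each factor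
  converges.\<close>

lemma centering_increment_tendsto:
  fixes a b :: "real \<Rightarrow> real" and k :: "nat \<Rightarrow> nat" and l :: "nat \<Rightarrow> real"
  assumes a: "a differentiable_on {0<..}" and a': "(deriv a \<longlongrightarrow> \<alpha>) at_top"
    and b: "((\<lambda>x. sqrt x / b x) \<longlongrightarrow> \<beta>) at_top"
    and l: "filterlim l at_top sequentially"
    and k: "(\<lambda>n. (real (k n) - l n) / sqrt (l n)) \<longlonglongrightarrow> t"
  shows "(\<lambda>n. (a (real (k n)) - a (l n)) / b (l n)) \<longlonglongrightarrow> (\<alpha> * \<beta>) * t"
proof -
  have l_pos: "eventually (\<lambda>n. l n > 0) sequentially"
    using l by (simp add: filterlim_at_top_dense)
  have sqrt_l: "filterlim (\<lambda>n. sqrt (l n)) at_top sequentially"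
    by (rule filterlim_compose[OF sqrt_at_top l])
  have "(\<lambda>n. 1 + (real (k n) - l n) / sqrt (l n) / sqrt (l n)) \<longlonglongrightarrow> 1 + 0"
    by (intro tendsto_add tendsto_const real_tendsto_divide_at_top[OF k sqrt_l])
  then have "filterlim (\<lambda>n. (1 + (real (k n) - l n) / sqrt (l n) / sqrt (l n)) * l n) at_top sequentially"
    by (rule filterlim_tendsto_pos_mult_at_top[OF _ _ l]) simp
  then have rk: "filterlim (\<lambda>n. real (k n)) at_top sequentially"
    by (rule filterlim_mono_eventually[OF _ order_refl order_refl])
       (use l_pos in eventually_elim, simp add: diff_divide_distrib distrib_right left_diff_distrib)
  have k_pos: "eventually (\<lambda>n. real (k n) > 0) sequentially"
    using rk unfolding filterlim_at_top_dense by blast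
  \<comment> \<open>The choice is made for every \<open>n\<close>, but has the stated property only
    once both endpoints are positive, hence eventually.\<close>
  define \<xi> where "\<xi> n = (SOME z. z \<ge> min (l n) (real (k n)) \<and> a (real (k n)) - a (l n) = deriv a z * (real (k n) - l n))" for n
  have \<xi>: "eventually (\<lambda>n. \<xi> n \<ge> min (l n) (real (k n)) \<and> a (real (k n)) - a (l n) = deriv a (\<xi> n) * (real (k n) - l n)) sequentially"
    using l_pos k_pos
  proof eventually_elim
    case (elim n)
    show ?case unfolding \<xi>_def by (rule someI_ex) (use mean_value_min[OF a elim] in blast)
  qed
  have "filterlim (\<lambda>n. min (l n) (real (k n))) at_top sequentially"
    unfolding filterlim_at_top
  proof
    fix Z
    show "eventually (\<lambda>n. Z \<le> min (l n) (real (k n))) sequentially"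
      using l[unfolded filterlim_at_top, rule_format, of Z] rk[unfolded filterlim_at_top, rule_format, of Z]
      by eventually_elim simp
  qed
  then have "filterlim \<xi> at_top sequentially"
    by (rule filterlim_at_top_mono) (use \<xi> in eventually_elim, simp)
  then have "(\<lambda>n. deriv a (\<xi> n)) \<longlonglongrightarrow> \<alpha>" by (rule filterlim_compose[OF a'])
  then have "(\<lambda>n. (deriv a (\<xi> n) * (sqrt (l n) / b (l n))) * ((real (k n) - l n) / sqrt (l n))) \<longlonglongrightarrow> (\<alpha> * \<beta>) * t"
    by (intro tendsto_mult filterlim_compose[OF b l] k)
  then show ?thesis
  proof (rule Lim_transform_eventually)
    show "eventually (\<lambda>n. (deriv a (\<xi> n) * (sqrt (l n) / b (l n))) * ((real (k n) - l n) / sqrt (l n)) = (a (real (k n)) - a (l n)) / b (l n)) sequentially"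
      using \<xi> l_pos by eventually_elim simp
  qed
qed

text \<open>Fubini reduces the convolution to the integral of the shifted mean \<open>\<Psi>\<close>
  against the law of \<open>s *\<^sub>R v\<close>, and the substitution \<open>s = c * t\<close>
  makes the density standard. The sign of \<open>c\<close> is free: the standard deviation is
  \<open>\<bar>c\<bar>\<close>.\<close>

lemma integral_convolution_normal_along:
  fixes f :: "'b::ordered_euclidean_space \<Rightarrow> real"
  assumes \<Lambda>: "prob_space \<Lambda>" "sets \<Lambda> = sets borel" and c: "c \<noteq> 0"
    and f[measurable]: "f \<in> borel_measurable borel" and fB: "\<And>y. \<bar>f y\<bar> \<le> B"
  shows "(\<integral>x. f x \<partial>convolution \<Lambda> (normal_along (c\<^sup>2) v)) =
    (\<integral>t. \<integral>y. f (y + (c * t) *\<^sub>R v) \<partial>\<Lambda> \<partial>std_normal_distribution)"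
proof -
  interpret \<Lambda>: prob_space \<Lambda> by (rule \<Lambda>)
  note \<Lambda>(2)[measurable_cong]
  let ?N = "density lborel (\<lambda>x. ennreal (normal_density 0 \<bar>c\<bar> x))"
  interpret N: prob_space ?N by (rule prob_space_normal_density) (use c in simp)
  interpret NA: prob_space "normal_along (c\<^sup>2) v"
    unfolding normal_along_def using c by (auto intro!: N.prob_space_distr)
  have [measurable_cong]: "sets (normal_along (c\<^sup>2) v) = sets borel" by (simp add: normal_along_def)
  interpret pair_prob_space \<Lambda> "normal_along (c\<^sup>2) v" ..
  define \<Psi> where "\<Psi> x = (\<integral>y. f (y + x) \<partial>\<Lambda>)" for x
  have [measurable]: "\<Psi> \<in> borel_measurable borel" unfolding \<Psi>_def by measurable
  have "(\<integral>x. f x \<partial>convolution \<Lambda> (normal_along (c\<^sup>2) v)) = (\<integral>(y, x). f (y + x) \<partial>(\<Lambda> \<Otimes>\<^sub>M normal_along (c\<^sup>2) v))"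
    unfolding convolution_def by (subst integral_distr) (auto intro!: Bochner_Integration.integral_cong)
  also have "\<dots> = (\<integral>x. \<Psi> x \<partial>normal_along (c\<^sup>2) v)"
    unfolding \<Psi>_def
    by (rule integral_snd[symmetric]) (auto intro!: integrable_const_bound[where B=B] simp: fB)
  also have "\<dots> = (\<integral>s. \<Psi> (s *\<^sub>R v) \<partial>?N)"
    unfolding normal_along_def by (subst integral_distr) auto
  also have "\<dots> = (\<integral>s. normal_density 0 \<bar>c\<bar> s * \<Psi> (s *\<^sub>R v) \<partial>lborel)"
    by (subst integral_density) auto
  also have "\<dots> = \<bar>c\<bar> * (\<integral>t. normal_density 0 \<bar>c\<bar> (c * t) * \<Psi> ((c * t) *\<^sub>R v) \<partial>lborel)"
    using c by (subst lborel_integral_real_affine[where c=c and t=0]) auto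
  also have "\<dots> = (\<integral>t. (\<bar>c\<bar> * normal_density 0 \<bar>c\<bar> (c * t)) * \<Psi> ((c * t) *\<^sub>R v) \<partial>lborel)"
    by (simp add: mult.assoc)
  also have "\<dots> = (\<integral>t. std_normal_density t * \<Psi> ((c * t) *\<^sub>R v) \<partial>lborel)"
  proof -
    have "\<bar>c\<bar> * normal_density 0 \<bar>c\<bar> (c * t) = std_normal_density t" for t
      using c by (simp add: normal_density_def real_sqrt_mult power_mult_distrib)
    then show ?thesis by simp
  qed
  also have "\<dots> = (\<integral>t. \<Psi> ((c * t) *\<^sub>R v) \<partial>std_normal_distribution)"
    by (subst integral_density) auto
  finally show ?thesis by (simp add: \<Psi>_def)
qed

section \<open>The three regimes of centering and scaling\<close>

theorem theorem3p3:
  fixes S :: "(real ^ 'd) set"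
    and R :: "real ^ 'd \<Rightarrow> (real ^ 'd) measure"
    and U\<^sub>0 :: "(real ^ 'd) measure"
    and \<Omega> :: "'w measure"
    and U :: "nat \<Rightarrow> 'w \<Rightarrow> (real ^ 'd) measure"
    and Z :: "nat \<Rightarrow> 'w \<Rightarrow> real ^ 'd"
    and \<Lambda> :: "(real ^ 'd) measure"
    and v :: "real ^ 'd"
    and a b :: "real \<Rightarrow> real"
  assumes S_nonempty: "S \<noteq> {}"
    and S_Polish: "Polish_topology (top_of_set S)"
    and R_kernel: "R \<in> restrict_space borel S \<rightarrow>\<^sub>M prob_algebra (restrict_space borel S)"
    and U0_prob: "prob_space U\<^sub>0" "sets U\<^sub>0 = sets (restrict_space borel S)"
    and urn: "urn_model \<Omega> (restrict_space borel S) R U\<^sub>0 U Z"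
    and \<Lambda>_prob: "prob_space \<Lambda>" "sets \<Lambda> = sets borel"
    and b_nonneg: "\<And>x. x \<ge> 0 \<Longrightarrow> b x \<ge> 0"
    and chain_limit: "\<And>\<mu> (\<Omega>' :: (nat \<Rightarrow> real ^ 'd) measure) X.
      prob_space \<mu> \<Longrightarrow> sets \<mu> = sets (restrict_space borel S) \<Longrightarrow>
      markov_chain \<Omega>' (restrict_space borel S) R \<mu> X \<Longrightarrow>
      converges_in_distribution \<Omega>'
        (\<lambda>n \<omega>. (X n \<omega> - a (real n) *\<^sub>R v) /\<^sub>R b (real n)) \<Lambda>"
  shows
    "((\<forall>x\<ge>0. a x = 0) \<and> (\<forall>x\<ge>0. b x = 1) \<longrightarrow>
        converges_in_distribution \<Omega> Z \<Lambda>)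
     \<and>
     ((\<forall>x\<ge>0. a x = 0) \<and> regularly_varying b \<longrightarrow>
        converges_in_distribution \<Omega>
          (\<lambda>n \<omega>. (Z n \<omega> - a (ln (real n)) *\<^sub>R v) /\<^sub>R b (ln (real n))) \<Lambda>)
     \<and>
     (\<forall>a_lim b_lim :: real.
        a differentiable_on {0<..} \<and> (deriv a \<longlongrightarrow> a_lim) at_top \<and>
        regularly_varying b \<and> ((\<lambda>x. sqrt x / b x) \<longlongrightarrow> b_lim) at_top \<longrightarrow>
        converges_in_distribution \<Omega>
          (\<lambda>n \<omega>. (Z n \<omega> - a (ln (real n)) *\<^sub>R v) /\<^sub>R b (ln (real n)))
          (if a_lim = 0 \<or> b_lim = 0 then \<Lambda>
           else convolution \<Lambda> (normal_along (a_lim\<^sup>2 * b_lim\<^sup>2) v)))"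
proof -
  interpret urn_model \<Omega> "restrict_space borel S" R U\<^sub>0 U Z by (rule urn)
  let ?M = "restrict_space borel S"
  \<comment> \<open>The mixture representation involves the chain started from
    \<open>U\<^sub>0\<close>; its marginals become \<open>\<nu>\<close>.\<close>
  obtain \<Omega>' :: "(nat \<Rightarrow> real ^ 'd) measure" and X where X: "markov_chain \<Omega>' ?M R U\<^sub>0 X"
    using markov_chain_exists[OF R_kernel U0_prob] by blast
  interpret X: markov_chain \<Omega>' ?M R U\<^sub>0 X by (rule X)
  define \<nu> where "\<nu> k = distr \<Omega>' ?M (X k)" for k
  have \<nu>_0: "\<nu> 0 = U\<^sub>0" by (simp add: \<nu>_def X.initial_law)
  have \<nu>_Suc: "\<nu> (Suc k) = \<nu> k \<bind> R" for k unfolding \<nu>_def by (rule X.distr_Suc)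
  have \<nu>: "\<nu> k \<in> space (prob_algebra ?M)" for k
    by (simp add: \<nu>_def space_prob_algebra X.prob_space_distr X.X_measurable)
  have id_M: "(\<lambda>x. x) \<in> ?M \<rightarrow>\<^sub>M borel" by (simp add: measurable_restrict_space1)
  have aff: "(\<lambda>x. (x - p *\<^sub>R v) /\<^sub>R q) \<in> ?M \<rightarrow>\<^sub>M borel" for p q
    using measurable_compose[OF id_M, of "\<lambda>x. (x - p *\<^sub>R v) /\<^sub>R q" borel] by simp
  have conv: "weakly_converges (\<lambda>k. distr (\<nu> k) borel (\<lambda>x. (x - a (real k) *\<^sub>R v) /\<^sub>R b (real k))) \<Lambda>"
    using chain_limit[OF U0_prob X]
    by (simp add: converges_in_distribution_def \<nu>_def distr_distr[OF aff X.X_measurable] comp_def)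
  note limit = urn_scaling_limit[OF urn id_M \<nu>_0 \<nu>_Suc \<nu> \<Lambda>_prob conv]
  have bounded_real: "\<exists>B. \<forall>y. \<bar>f y\<bar> \<le> B" if "bounded (range f)" for f :: "real ^ 'd \<Rightarrow> real"
    using that by (auto simp: bounded_iff)
  interpret N: real_distribution std_normal_distribution by (rule real_dist_normal_dist)

  have part_b: "converges_in_distribution \<Omega>
      (\<lambda>n \<omega>. (Z n \<omega> - a (ln (real n)) *\<^sub>R v) /\<^sub>R b (ln (real n))) \<Lambda>"
    if a0: "\<forall>x\<ge>0. a x = 0" and b: "regularly_varying b"
    unfolding converges_in_distribution_def weakly_converges_def
  proof (intro allI impI, elim conjE)
    fix f :: "real ^ 'd \<Rightarrow> real" assume f: "continuous_on UNIV f" "bounded (range f)"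
    obtain B where B: "\<And>y. \<bar>f y\<bar> \<le> B" using bounded_real[OF f(2)] by blast
    \<comment> \<open>The case \<open>n = 0\<close> is covered by the convention
      \<open>ln 0 = 0\<close>, so the argument of \<open>a\<close> is never negative.\<close>
    have "a (ln (real n)) = 0" for n using a0 by (cases n) auto
    then have "(\<lambda>n. (a (real (k n)) - a (ln (real n))) / b (ln (real n))) \<longlonglongrightarrow> 0 * t" for k :: "nat \<Rightarrow> nat" and t
      using a0 by simp
    from limit[OF b this f(1) B]
    show "(\<lambda>n. \<integral>x. f x \<partial>distr \<Omega> borel (\<lambda>\<omega>. (Z n \<omega> - a (ln (real n)) *\<^sub>R v) /\<^sub>R b (ln (real n)))) \<longlonglongrightarrow> (\<integral>x. f x \<partial>\<Lambda>)"
      using N.prob_space by simp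
  qed
  have part_a: "converges_in_distribution \<Omega> Z \<Lambda>"
    if a0: "\<forall>x\<ge>0. a x = 0" and b1: "\<forall>x\<ge>0. b x = 1"
  proof -
    \<comment> \<open>Being \<open>1\<close> on the half-line, \<open>b\<close> is regularly varying
      with index \<open>0\<close>. Case (b) then applies, and its normalisation is trivial.\<close>
    have "b \<in> borel_measurable (restrict_space borel {0..}) \<longleftrightarrow> (\<lambda>_. 1 :: real) \<in> borel_measurable (restrict_space borel {0 :: real..})"
      using b1 by (intro measurable_cong) (simp add: space_restrict_space)
    moreover have "((\<lambda>x. b (c * x) / b x) \<longlongrightarrow> c powr 0) at_top" if "c > 0" for c
      by (rule tendsto_eventually, rule eventually_mono[OF eventually_gt_at_top[of 0]]) (use b1 that in simp)
    moreover have "eventually (\<lambda>x. b x > 0) at_top"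
      by (rule eventually_mono[OF eventually_gt_at_top[of 0]]) (use b1 in simp)
    ultimately have "regularly_varying b"
      unfolding regularly_varying_def by (auto intro!: exI[of _ 0])
    from part_b[OF a0 this] have "converges_in_distribution \<Omega>
      (\<lambda>n \<omega>. (Z n \<omega> - a (ln (real n)) *\<^sub>R v) /\<^sub>R b (ln (real n))) \<Lambda>" .
    moreover have "a (ln (real n)) = 0" "b (ln (real n)) = 1" for n
      using a0 b1 by (cases n; auto)+
    ultimately show ?thesis by simp
  qed
  have part_c: "converges_in_distribution \<Omega>
      (\<lambda>n \<omega>. (Z n \<omega> - a (ln (real n)) *\<^sub>R v) /\<^sub>R b (ln (real n)))
      (if a_lim = 0 \<or> b_lim = 0 then \<Lambda> else convolution \<Lambda> (normal_along (a_lim\<^sup>2 * b_lim\<^sup>2) v))"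
    if a: "a differentiable_on {0<..}" "(deriv a \<longlongrightarrow> a_lim) at_top"
      and b: "regularly_varying b" "((\<lambda>x. sqrt x / b x) \<longlongrightarrow> b_lim) at_top" for a_lim b_lim
    unfolding converges_in_distribution_def weakly_converges_def
  proof (intro allI impI, elim conjE)
    fix f :: "real ^ 'd \<Rightarrow> real" assume f: "continuous_on UNIV f" "bounded (range f)"
    obtain B where B: "\<And>y. \<bar>f y\<bar> \<le> B" using bounded_real[OF f(2)] by blast
    have ln_top: "filterlim (\<lambda>n. ln (real n)) at_top sequentially"
      by (rule filterlim_compose[OF ln_at_top filterlim_real_sequentially])
    \<comment> \<open>The mixed integral is the mean of \<open>f\<close> under the claimed limit:
      without displacement the outer integral averages a constant, otherwise it is a convolution
      with \<open>c = a_lim * b_lim\<close>.\<close>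
    have "(\<integral>t. \<integral>y. f (y + (a_lim * b_lim * t) *\<^sub>R v) \<partial>\<Lambda> \<partial>std_normal_distribution) =
      (\<integral>x. f x \<partial>(if a_lim = 0 \<or> b_lim = 0 then \<Lambda> else convolution \<Lambda> (normal_along (a_lim\<^sup>2 * b_lim\<^sup>2) v)))"
    proof (cases "a_lim * b_lim = 0")
      case True
      then show ?thesis using N.prob_space by auto
    next
      case False
      then show ?thesis
        using integral_convolution_normal_along[OF \<Lambda>_prob False borel_measurable_continuous_onI[OF f(1)] B, of v]
        by (simp add: power_mult_distrib)
    qed
    with limit[OF b(1) centering_increment_tendsto[OF a b(2) ln_top] f(1) B]
    show "(\<lambda>n. \<integral>x. f x \<partial>distr \<Omega> borel (\<lambda>\<omega>. (Z n \<omega> - a (ln (real n)) *\<^sub>R v) /\<^sub>R b (ln (real n)))) \<longlonglongrightarrow>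
      (\<integral>x. f x \<partial>(if a_lim = 0 \<or> b_lim = 0 then \<Lambda> else convolution \<Lambda> (normal_along (a_lim\<^sup>2 * b_lim\<^sup>2) v)))"
      by simp
  qed
  show ?thesis using part_a part_b part_c by blast
qed

end
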